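(* Let $g'$ be bounded on $[0,T+1]$ and let $U\subseteq D(0,T)$ be an open set satisfying the following exterior ball condition: there exists $\epsilon>0$ such that for every $z\in\partial U$ there exists $\eta\in U^c$ with $B(\eta,\epsilon)\subset U^c$ and $|z-\eta|=\epsilon$. Then $$\liminf_{n\to\infty}\frac1{n^2}\log\mathbf P\big[\mathcal X_n^{(g)}(U)=0\big]\ge-R_U^{(g)}-\limsup_{n\to\infty}\frac1{n^2}\log Z_n^{(g)}.$$
   Context: $m$ is Lebesgue measure on $\mathbb C$; $D(0,t)$ is the disk of radius $t$ centred at $0$; $B(\eta,\epsilon)$ is the ball of radius $\epsilon$ centred at $\eta$; $U^c=\mathbb C\setminus U$. The function $g:[0,\infty)\to[0,\infty)$ satisfies: (a) $g$ is increasing and $re^{-g(r)/2}\to0$ as $r\to\infty$; (b) $g$ is twice differentiable on $(0,\infty)$; (c) $\lim_{r\to0^+}rg'(r)=0$ and $rg'(r)$ is increasing on $(0,\infty)$; (d) $\int_0^\infty r^{2k+1}e^{-g(r)}dr<\infty$ for all $k=0,1,2,\dots$. $T>0$ is the (unique) solution of $tg'(t)=2$. At $0$, $g'$ is understood as a one-sided derivative. $\mathcal X_n^{(g)}$ is the determinantal point process of $n$ points in $\mathbb C$ whose vector of points (in uniform random order) has density $\frac1{Z_n^{(g)}}\prod_{i<j}|z_i-z_j|^2e^{-n\sum_{k=1}^ng(|z_k|)}$ with respect to Lebesgue measure on $\mathbb C^n$, where $Z_n^{(g)}=\int_{\mathbb C}\cdots\int_{\mathbb C}\prod_{i<j}|z_i-z_j|^2e^{-n\sum_{k=1}^ng(|z_k|)}\prod_{k=1}^ndm(z_k)$.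 $\mathcal X_n^{(g)}(\Omega)$ is the number of its points in $\Omega$. $\mathcal P(E)$ is the set of compactly supported probability measures with support in $E$. For $\mu\in\mathcal P(\mathbb C)$, $R_\mu^{(g)}=\iint\log\frac1{|z-w|}d\mu(z)d\mu(w)+\int g(|z|)d\mu(z)$, and $R_U^{(g)}=\inf\{R_\mu^{(g)}:\mu\in\mathcal P(U^c)\}$. *)

theory Defs
  imports "HOL-Probability.Probability"
begin

text \<open>
  The logarithm of a nonnegative real as an extended real. The library function \<^const>\<open>ln\<close> is
  total on the reals with junk values, so the value at 0 has to be set by hand.
\<close>
definition ereal_ln :: "real \<Rightarrow> ereal" where
  "ereal_ln x = (if x \<le> 0 then - \<infinity> else ereal (ln x))"

text \<open>
  Integral of an extended-real function: positive part minus negative part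
  (\<^const>\<open>e2ennreal\<close> sends negative numbers to 0). It is only meaningful when one of the two
  parts has a finite integral; for the logarithmic kernel and a compactly supported measure the
  negative part is bounded.
\<close>
definition ereal_integral :: "'a measure \<Rightarrow> ('a \<Rightarrow> ereal) \<Rightarrow> ereal" where
  "ereal_integral M f =
     enn2ereal (\<integral>\<^sup>+ x. e2ennreal (f x) \<partial>M) - enn2ereal (\<integral>\<^sup>+ x. e2ennreal (- f x) \<partial>M)"

text \<open>
  The standing assumptions on \<open>g\<close>, which matters only on \<open>[0, \<infinity>)\<close>; \<open>g'\<close> is its derivative on
  \<open>(0, \<infinity>)\<close>. ``Increasing'' is read in the weak sense. The integrand in the last clause is
  nonnegative and measurable, so integrability is finiteness of the integral.
\<close>
definition admissible_potential :: "(real \<Rightarrow> real) \<Rightarrow> (real \<Rightarrow> real) \<Rightarrow> bool" where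
  "admissible_potential g g' \<longleftrightarrow>
     (\<forall>r\<ge>0. g r \<ge> 0) \<and>
     mono_on {0..} g \<and>
     ((\<lambda>r. r * exp (- g r / 2)) \<longlongrightarrow> 0) at_top \<and>
     (\<forall>r>0. (g has_real_derivative g' r) (at r)) \<and>
     (\<forall>r>0. g' differentiable (at r)) \<and>
     ((\<lambda>r. r * g' r) \<longlongrightarrow> 0) (at_right 0) \<and>
     mono_on {0<..} (\<lambda>r. r * g' r) \<and>
     (\<forall>k::nat. set_integrable lborel {0..} (\<lambda>r. r ^ (2 * k + 1) * exp (- g r)))"

text \<open>
  Points of \<open>\<complex>\<^sup>n\<close> are functions on the index set \<open>{..<n}\<close>, and Lebesgue measure on \<open>\<complex>\<^sup>n\<close> is the
  product measure.
\<close>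
definition lebesgue_n :: "nat \<Rightarrow> (nat \<Rightarrow> complex) measure" where
  "lebesgue_n n = (\<Pi>\<^sub>M k\<in>{..<n}. lborel)"

definition ensemble_weight :: "(real \<Rightarrow> real) \<Rightarrow> nat \<Rightarrow> (nat \<Rightarrow> complex) \<Rightarrow> real" where
  "ensemble_weight g n z =
     (\<Prod>j<n. \<Prod>i<j. (cmod (z i - z j))\<^sup>2) * exp (- real n * (\<Sum>k<n. g (cmod (z k))))"

definition partition_fun :: "(real \<Rightarrow> real) \<Rightarrow> nat \<Rightarrow> real" where
  "partition_fun g n = (\<integral>z. ensemble_weight g n z \<partial>lebesgue_n n)"

text \<open>The law of the vector of the points of the process, taken in uniform random order.\<close>
definition ensemble_law :: "(real \<Rightarrow> real) \<Rightarrow> nat \<Rightarrow> (nat \<Rightarrow> complex) measure" where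
  "ensemble_law g n =
     density (lebesgue_n n) (\<lambda>z. ennreal (ensemble_weight g n z / partition_fun g n))"

definition num_points :: "nat \<Rightarrow> (nat \<Rightarrow> complex) \<Rightarrow> complex set \<Rightarrow> nat" where
  "num_points n z \<Omega> = card {k. k < n \<and> z k \<in> \<Omega>}"

definition hole_prob :: "(real \<Rightarrow> real) \<Rightarrow> nat \<Rightarrow> complex set \<Rightarrow> real" where
  "hole_prob g n U = \<P>(z in ensemble_law g n. num_points n z U = 0)"

definition measure_support :: "'a::topological_space measure \<Rightarrow> 'a set" where
  "measure_support \<mu> = {x. \<forall>V. open V \<and> x \<in> V \<longrightarrow> emeasure \<mu> V > 0}"

definition compact_prob_measures :: "complex set \<Rightarrow> complex measure set" where
  "compact_prob_measures E =
     {\<mu>. prob_space \<mu> \<and> sets \<mu> = sets borel \<and>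
         compact (measure_support \<mu>) \<and> measure_support \<mu> \<subseteq> E}"

text \<open>
  The kernel \<open>log (1 / |z - w|)\<close> is written as \<open>- log |z - w|\<close>, so that it is \<open>+\<infinity>\<close> on the
  diagonal (in HOL \<open>1 / 0 = 0\<close>).
\<close>
definition weighted_energy :: "(real \<Rightarrow> real) \<Rightarrow> complex measure \<Rightarrow> ereal" where
  "weighted_energy g \<mu> =
     ereal_integral (\<mu> \<Otimes>\<^sub>M \<mu>) (\<lambda>(z, w). - ereal_ln (cmod (z - w)))
     + ereal (\<integral>z. g (cmod z) \<partial>\<mu>)"

definition min_energy :: "(real \<Rightarrow> real) \<Rightarrow> complex set \<Rightarrow> ereal" where
  "min_energy g U = (INF \<mu>\<in>compact_prob_measures (- U). weighted_energy g \<mu>)"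

definition exterior_ball_condition :: "complex set \<Rightarrow> bool" where
  "exterior_ball_condition U \<longleftrightarrow>
     (\<exists>\<epsilon>>0. \<forall>z\<in>frontier U. \<exists>\<eta>\<in>- U. ball \<eta> \<epsilon> \<subseteq> - U \<and> cmod (z - \<eta>) = \<epsilon>)"

end

theory Submission
  imports Defs
begin

text \<open>
  Write \<open>I\<^sub>n\<close> for the integral of the weight over the configurations that avoid \<open>U\<close>. The hole probability is
  \<open>I\<^sub>n / Z\<^sub>n\<close>, so it suffices to show \<open>liminf n\<^sup>-\<^sup>2 log I\<^sub>n \<ge> - R\<^sub>\<mu>\<close> for each compactly supported probability
  measure \<open>\<mu>\<close> outside \<open>U\<close> of finite weighted energy \<open>R\<^sub>\<mu>\<close>, together with the fact that
  \<open>n\<^sup>-\<^sup>2 log Z\<^sub>n\<close> stays bounded, which keeps the extended-real arithmetic meaningful.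
  
  If \<open>\<mu>\<close> has density at most \<open>M\<close>, then \<open>I\<^sub>n\<close> is at least \<open>M\<^sup>-\<^sup>n\<close> times the mean of the weight under \<open>n\<close>
  independent points of law \<open>\<mu>\<close>, and Jensen's inequality bounds that mean below by
  \<open>exp (- n\<^sup>2 R\<^sub>\<mu> + O(n))\<close>. This is \<open>hole_integral_lower\<close>.
  
  A general \<open>\<mu>\<close> is first smoothed at a small scale \<open>\<delta>\<close>. By the exterior ball condition each point \<open>z\<close> outside
  \<open>U\<close> has within distance \<open>2 \<delta>\<close> the centre of a disc of radius \<open>\<delta>\<close> outside \<open>U\<close>, and the mass at \<open>z\<close> is spread
  uniformly over a disc of this kind, chosen measurably. The kernel is changed little for pairs at a distance
  much larger than \<open>\<delta>\<close>, and raised by at most a constant for the other pairs; the latter carry a mass tending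
  to 0, because a measure of finite energy does not charge the diagonal. Hence the energy is increased by an
  arbitrarily small amount (\<open>approximation_by_bounded_densities\<close>).
\<close>

section \<open>Integrals over the complex plane\<close>

lemma nn_integral_le_scaled:
  assumes sets: "sets N = sets M"
    and le: "\<And>A. A \<in> sets M \<Longrightarrow> emeasure N A \<le> c * emeasure M A"
    and f: "f \<in> borel_measurable M"
  shows "(\<integral>\<^sup>+x. f x \<partial>N) \<le> c * (\<integral>\<^sup>+x. f x \<partial>M)"
  using f
proof (induction rule: borel_measurable_induct)
  case (cong f g)
  have "integral\<^sup>N N f = integral\<^sup>N N g" "integral\<^sup>N M f = integral\<^sup>N M g"
    using cong(3) sets_eq_imp_space_eq[OF sets] by (auto intro!: nn_integral_cong)
  with cong(4) show ?case by simp
next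
  case (set A)
  then show ?case using le sets by simp
next
  case (mult u k)
  have "u \<in> borel_measurable N" using mult(2) sets by (simp cong: measurable_cong_sets)
  then have "(\<integral>\<^sup>+x. k * u x \<partial>N) = k * (\<integral>\<^sup>+x. u x \<partial>N)" by (rule nn_integral_cmult)
  also have "\<dots> \<le> k * (c * (\<integral>\<^sup>+x. u x \<partial>M))" using mult by (intro mult_left_mono) auto
  finally show ?case using mult by (simp add: nn_integral_cmult mult.left_commute)
next
  case (add u v)
  have "u \<in> borel_measurable N" "v \<in> borel_measurable N" 
    using add(1,3) sets by (simp_all cong: measurable_cong_sets)
  then show ?case using add by (simp add: nn_integral_add distrib_left add_mono)
next
  case (seq U)
  have m: "U i \<in> borel_measurable N" for i using seq(1) sets by (simp cong: measurable_cong_sets)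
  have "(\<integral>\<^sup>+x. (SUP i. U i x) \<partial>N) = (SUP i. \<integral>\<^sup>+x. U i x \<partial>N)"
    by (rule nn_integral_monotone_convergence_SUP) (use seq m in auto)
  also have "\<dots> \<le> (SUP i. c * \<integral>\<^sup>+x. U i x \<partial>M)" by (rule SUP_mono') (use seq in auto)
  also have "\<dots> = c * (SUP i. \<integral>\<^sup>+x. U i x \<partial>M)" by (simp add: SUP_mult_left_ennreal)
  also have "(SUP i. \<integral>\<^sup>+x. U i x \<partial>M) = (\<integral>\<^sup>+x. (SUP i. U i x) \<partial>M)"
    by (rule nn_integral_monotone_convergence_SUP[symmetric]) (use seq in auto)
  finally show ?case by (simp add: image_comp)
qed

lemma emeasure_complex_ball:
  "r \<ge> 0 \<Longrightarrow> emeasure lborel (ball (c::complex) r) = ennreal (pi * r\<^sup>2)"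
  using emeasure_ball[of r c] unit_ball_vol_2 by simp

text \<open>
  For \<open>r < d\<close> at least \<open>log\<^sub>2 (d / r)\<close> of the dyadic radii \<open>d / 2\<^sup>k\<close> exceed \<open>r\<close>. The logarithmic
  singularity is thus dominated by a sum of indicators of discs, whose areas form a geometric series.
  Negative values of the logarithm are cut off by \<^const>\<open>ennreal\<close>.
\<close>
lemma ln_le_sum_dyadic_indicators:
  fixes r d :: real
  assumes "d > 0" "r \<ge> 0"
  shows "ennreal (ln (d / r)) \<le> (\<Sum>k. indicator {..<d / 2 ^ k} r)"
proof (cases "r = 0 \<or> r \<ge> d")
  case True
  then have "ln (d / r) \<le> 0" using assms by (auto simp: ln_le_zero_iff divide_le_eq_1)
  then show ?thesis by (simp add: ennreal_neg)
next
  case False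
  then have r: "0 < r" "r < d" using assms by auto
  define x where "x = log 2 (d / r)"
  define N where "N = nat \<lceil>x\<rceil>"
  have lnx: "ln (d / r) = ln 2 * x" using r by (simp add: x_def log_def)
  have "x > 0" using r by (simp add: x_def zero_less_log_cancel_iff)
  have ln2: "ln 2 * x \<le> x"
    using \<open>x > 0\<close> ln_2_less_1 mult_right_mono[of "ln 2" 1 x] by linarith
  have in_k: "r < d / 2 ^ k" if "k < N" for k
  proof -
    have "real k < x" using that \<open>x > 0\<close> unfolding N_def by linarith
    then have "2 powr real k < d / r" using r by (simp add: x_def less_log_iff)
    then show ?thesis using r by (simp add: powr_realpow field_simps)
  qed
  have "ln (d / r) \<le> real N" using lnx ln2 unfolding N_def by linarith
  then have "ennreal (ln (d / r)) \<le> ennreal (real N)" by (rule ennreal_leI)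
  also have "\<dots> = (\<Sum>k<N. indicator {..<d / 2 ^ k} r)"
    using in_k by (simp add: ennreal_of_nat_eq_real_of_nat)
  also have "\<dots> \<le> (\<Sum>k. indicator {..<d / 2 ^ k} r)"
    by (rule sum_le_suminf) auto
  finally show ?thesis .
qed

lemma nn_integral_ln_singularity:
  fixes c :: complex
  assumes "d > 0"
  shows "(\<integral>\<^sup>+w. ennreal (ln (d / cmod (w - c))) \<partial>lborel) \<le> ennreal (2 * pi * d\<^sup>2)"
proof -
  have "(\<integral>\<^sup>+w. ennreal (ln (d / cmod (w - c))) \<partial>lborel)
      \<le> (\<integral>\<^sup>+w. (\<Sum>k. indicator (ball c (d / 2 ^ k)) w) \<partial>lborel)"
  proof (rule nn_integral_mono)
    fix w :: complex
    have "ennreal (ln (d / cmod (w - c))) \<le> (\<Sum>k. indicator {..<d / 2 ^ k} (cmod (w - c)))"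
      using assms by (intro ln_le_sum_dyadic_indicators) auto
    also have "\<dots> = (\<Sum>k. indicator (ball c (d / 2 ^ k)) w)"
      by (intro suminf_cong) (auto simp: indicator_def dist_norm norm_minus_commute)
    finally show "ennreal (ln (d / cmod (w - c))) \<le> (\<Sum>k. indicator (ball c (d / 2 ^ k)) w)" .
  qed
  also have "\<dots> = (\<Sum>k. \<integral>\<^sup>+w. indicator (ball c (d / 2 ^ k)) w \<partial>lborel)"
    by (rule nn_integral_suminf) (auto intro!: borel_measurable_indicator)
  also have "\<dots> = (\<Sum>k. ennreal (pi * d\<^sup>2 * (1 / 4) ^ k))"
  proof (rule suminf_cong)
    fix k
    have "(2 ^ k)\<^sup>2 = (4::real) ^ k" by (simp add: power2_eq_square flip: power_mult_distrib)
    then show "(\<integral>\<^sup>+w. indicator (ball c (d / 2 ^ k)) w \<partial>lborel) = ennreal (pi * d\<^sup>2 * (1 / 4) ^ k)"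
      using assms by (simp add: emeasure_complex_ball power_divide)
  qed
  also have "\<dots> = ennreal (\<Sum>k. pi * d\<^sup>2 * (1 / 4) ^ k)"
    by (rule suminf_ennreal2) (auto intro: summable_mult summable_geometric)
  also have "(\<Sum>k. pi * d\<^sup>2 * (1 / 4) ^ k) = pi * d\<^sup>2 * (4 / 3)"
    by (subst suminf_mult) (auto simp: suminf_geometric summable_geometric)
  also have "ennreal \<dots> \<le> ennreal (2 * pi * d\<^sup>2)" by (intro ennreal_leI) simp
  finally show ?thesis .
qed

text \<open>
  A probability measure of density at most \<open>M\<close> has its logarithmic potential bounded uniformly in the
  point. For the uniform distribution on a disc of radius \<open>d\<close>, where \<open>M = 1 / (\<pi> d\<^sup>2)\<close>, the bound is
  \<open>ln (D / d) + 2\<close>.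
\<close>
lemma nn_integral_ln_bounded_density:
  fixes \<nu> :: "complex measure"
  assumes "prob_space \<nu>" "sets \<nu> = sets borel" "M \<ge> 0"
    and le: "\<And>A. A \<in> sets borel \<Longrightarrow> emeasure \<nu> A \<le> ennreal M * emeasure lborel A"
    and d: "0 < d" "d \<le> D"
  shows "(\<integral>\<^sup>+w. ennreal (ln (D / cmod (w - c))) \<partial>\<nu>) \<le> ennreal (ln (D / d) + M * (2 * pi * d\<^sup>2))"
proof -
  interpret prob_space \<nu> by fact
  note [measurable_cong] = assms(2)
  have "(\<integral>\<^sup>+w. ennreal (ln (D / cmod (w - c))) \<partial>\<nu>)
      \<le> (\<integral>\<^sup>+w. ennreal (ln (D / d)) + ennreal (ln (d / cmod (w - c))) \<partial>\<nu>)"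
  proof (rule nn_integral_mono)
    fix w
    show "ennreal (ln (D / cmod (w - c))) \<le> ennreal (ln (D / d)) + ennreal (ln (d / cmod (w - c)))"
    proof (cases "w = c")
      case False
      have "ln (D / cmod (w - c)) = ln (D / d) + ln (d / cmod (w - c))"
        using d False by (simp add: ln_div)
      moreover have "ln (D / d) \<ge> 0" using d by simp
      ultimately show ?thesis
        by (cases "ln (d / cmod (w - c)) \<ge> 0") (auto simp: ennreal_neg ennreal_leI simp flip: ennreal_plus)
    qed simp
  qed
  also have "\<dots> = ennreal (ln (D / d)) + (\<integral>\<^sup>+w. ennreal (ln (d / cmod (w - c))) \<partial>\<nu>)"
    by (subst nn_integral_add) (auto simp: emeasure_space_1)
  also have "(\<integral>\<^sup>+w. ennreal (ln (d / cmod (w - c))) \<partial>\<nu>)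
      \<le> ennreal M * (\<integral>\<^sup>+w. ennreal (ln (d / cmod (w - c))) \<partial>lborel)"
    by (rule nn_integral_le_scaled) (use assms in auto)
  also have "\<dots> \<le> ennreal M * ennreal (2 * pi * d\<^sup>2)"
    by (intro mult_left_mono nn_integral_ln_singularity) (use d in auto)
  also have "ennreal (ln (D / d)) + \<dots> = ennreal (ln (D / d) + M * (2 * pi * d\<^sup>2))"
    using assms by (simp add: ennreal_mult'[symmetric] ennreal_plus[symmetric] del: ennreal_plus)
  finally show ?thesis by (simp add: add_left_mono)
qed

lemma nn_integral_inverse_fourth_power_complex:
  "(\<integral>\<^sup>+z. ennreal (1 / (1 + cmod z) ^ 4) \<partial>lborel) < \<infinity>"
proof -
  \<comment> \<open>\<open>(1 + x\<^sup>2) (1 + y\<^sup>2) \<le> (1 + \<bar>x + iy\<bar>)\<^sup>4\<close> reduces the integral to a product of two integrals over the line.\<close>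
  have "(\<integral>\<^sup>+z. ennreal (1 / (1 + cmod z) ^ 4) \<partial>lborel)
     \<le> (\<integral>\<^sup>+(z::complex). (\<Prod>b\<in>Basis. ennreal (inverse (1 + (z \<bullet> b)\<^sup>2))) \<partial>lborel)"
  proof (rule nn_integral_mono)
    fix z :: complex
    have a: "1 + (Re z)\<^sup>2 \<le> (1 + cmod z)\<^sup>2" "1 + (Im z)\<^sup>2 \<le> (1 + cmod z)\<^sup>2"
      unfolding power2_sum using abs_Re_le_cmod[of z] abs_Im_le_cmod[of z]
      by (auto simp: abs_le_square_iff[symmetric] intro!: add_mono add_increasing2)
    have "(1 + (Re z)\<^sup>2) * (1 + (Im z)\<^sup>2) \<le> (1 + cmod z)\<^sup>2 * (1 + cmod z)\<^sup>2"
      by (rule mult_mono[OF a]) auto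
    also have "\<dots> = (1 + cmod z) ^ 4" by (simp add: power_add[symmetric])
    finally have "inverse ((1 + cmod z) ^ 4) \<le> inverse ((1 + (Re z)\<^sup>2) * (1 + (Im z)\<^sup>2))"
      by (intro le_imp_inverse_le) (auto intro!: mult_pos_pos add_pos_nonneg)
    then have "ennreal (1 / (1 + cmod z) ^ 4) \<le> ennreal (inverse (1 + (Re z)\<^sup>2) * inverse (1 + (Im z)\<^sup>2))"
      by (intro ennreal_leI) (simp add: divide_inverse)
    also have "\<dots> = (\<Prod>b\<in>Basis. ennreal (inverse (1 + (z \<bullet> b)\<^sup>2)))"
      by (simp add: Basis_complex_def ennreal_mult' inner_complex_def)
    finally show "ennreal (1 / (1 + cmod z) ^ 4) \<le> (\<Prod>b\<in>Basis. ennreal (inverse (1 + (z \<bullet> b)\<^sup>2)))" .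
  qed
  also have "\<dots> = (\<Prod>b\<in>(Basis::complex set). (\<integral>\<^sup>+x. ennreal (inverse (1 + x\<^sup>2)) \<partial>lborel))"
    by (rule nn_integral_lborel_prod) auto
  also have "\<dots> < \<infinity>"
  proof -
    have "integrable lborel (\<lambda>x::real. inverse (1 + x\<^sup>2))"
      using integrable_inverse_1_plus_square by (simp add: set_integrable_def)
    from nn_integral_eq_integral[OF this] have "(\<integral>\<^sup>+x. ennreal (inverse (1 + x\<^sup>2)) \<partial>lborel) < \<infinity>"
      by simp
    then show ?thesis by (simp add: Basis_complex_def ennreal_mult_less_top)
  qed
  finally show ?thesis .
qed

section \<open>An upper bound for the partition function\<close>

lemma admissible_potentialD:
  assumes "admissible_potential g g'"
  shows "\<And>r. r \<ge> 0 \<Longrightarrow> g r \<ge> 0"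
    and "\<And>r s. 0 \<le> r \<Longrightarrow> r \<le> s \<Longrightarrow> g r \<le> g s"
    and "((\<lambda>r. r * exp (- g r / 2)) \<longlongrightarrow> 0) at_top"
    and "set_integrable lborel {0..} (\<lambda>r. r ^ (2 * k + 1) * exp (- g r))"
  using assms unfolding admissible_potential_def by (auto simp: mono_on_def)

lemma admissible_potential_continuous:
  assumes "admissible_potential g g'" "(g has_real_derivative c) (at 0 within {0..})"
  shows "continuous_on {0..} g"
  unfolding continuous_on_eq_continuous_within
proof
  fix r :: real assume "r \<in> {0..}"
  show "continuous (at r within {0..}) g"
  proof (cases "r = 0")
    case True
    then show ?thesis using assms(2) by (auto intro: DERIV_continuous)
  next
    case False
    then have "(g has_real_derivative g' r) (at r)"
      using assms(1) \<open>r \<in> {0..}\<close> unfolding admissible_potential_def by auto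
    then show ?thesis by (meson DERIV_isCont continuous_at_imp_continuous_at_within)
  qed
qed

lemma measurable_radial:
  assumes "continuous_on {0..} g"
  shows "(\<lambda>z. g (cmod z)) \<in> borel_measurable borel"
  by (intro borel_measurable_continuous_onI continuous_on_compose2[OF assms])
     (auto intro: continuous_intros)

text \<open>
  \<open>exp (- g)\<close> is decreasing, so its third moment is at least that of \<open>{r / 2..r}\<close>, which is at least
  \<open>r\<^sup>4 exp (- g r) / 16\<close>. Finiteness of the moment then gives pointwise decay fast enough for
  integrability over the plane.
\<close>
lemma exp_neg_potential_decay:
  assumes adm: "admissible_potential g g'"
  obtains C where "C \<ge> 0" "\<And>r. r \<ge> 0 \<Longrightarrow> exp (- g r) \<le> C / (1 + r) ^ 4"
proof -
  note g = admissible_potentialD[OF adm]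
  define F where "F = (\<lambda>r. indicator {0..} r * (r ^ 3 * exp (- g r)))"
  have F: "integrable lborel F"
    using g(4)[of 1] by (simp add: set_integrable_def F_def)
  have F0: "F r \<ge> 0" for r by (auto simp: F_def indicator_def)
  define A where "A = (\<integral>r. F r \<partial>lborel)"
  have A0: "A \<ge> 0" unfolding A_def using F0 by simp
  have A: "(\<integral>\<^sup>+r. ennreal (F r) \<partial>lborel) = ennreal A"
    unfolding A_def by (rule nn_integral_eq_integral[OF F]) (use F0 in auto)
  have tail: "r ^ 4 * exp (- g r) \<le> 16 * A" if "r > 0" for r
  proof -
    have "ennreal ((r / 2) ^ 3 * exp (- g r) * (r / 2))
        = (\<integral>\<^sup>+s. ennreal ((r / 2) ^ 3 * exp (- g r)) * indicator {r / 2..r} s \<partial>lborel)"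
      using that by (subst nn_integral_cmult_indicator) (auto simp: ennreal_mult'[symmetric])
    also have "\<dots> \<le> (\<integral>\<^sup>+s. ennreal (F s) \<partial>lborel)"
    proof (rule nn_integral_mono)
      fix s
      show "ennreal ((r / 2) ^ 3 * exp (- g r)) * indicator {r / 2..r} s \<le> ennreal (F s)"
      proof (cases "s \<in> {r / 2..r}")
        case True
        then have "(r / 2) ^ 3 * exp (- g r) \<le> s ^ 3 * exp (- g s)"
          using that g(2)[of s r] by (intro mult_mono power_mono) auto
        then show ?thesis using True that by (auto simp: F_def intro!: ennreal_leI)
      qed auto
    qed
    finally have "(r / 2) ^ 3 * exp (- g r) * (r / 2) \<le> A" using A A0 by simp
    moreover have "(r / 2) ^ 3 * exp (- g r) * (r / 2) = r ^ 4 * exp (- g r) / 16"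
      by (simp add: power_divide eval_nat_numeral)
    ultimately show ?thesis by linarith
  qed
  show ?thesis
  proof (rule that[of "16 + 256 * A"])
    fix r :: real assume r: "r \<ge> 0"
    have "(1 + r) ^ 4 * exp (- g r) \<le> 16 + 256 * A"
    proof (cases "r \<le> 1")
      case True
      have "(1 + r) ^ 4 * exp (- g r) \<le> 2 ^ 4 * 1"
        using r True g(1)[OF r] by (intro mult_mono power_mono) auto
      then show ?thesis using A0 by simp
    next
      case False
      have "(1 + r) ^ 4 * exp (- g r) \<le> (2 * r) ^ 4 * exp (- g r)"
        using False by (intro mult_right_mono power_mono) auto
      also have "\<dots> = 16 * (r ^ 4 * exp (- g r))" by (simp add: power_mult_distrib)
      also have "\<dots> \<le> 16 * (16 * A)" using tail[of r] False by (intro mult_left_mono) linarith+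
      finally show ?thesis by simp
    qed
    then show "exp (- g r) \<le> (16 + 256 * A) / (1 + r) ^ 4"
      using r by (simp add: pos_le_divide_eq mult.commute)
  qed (use A0 in simp)
qed

lemma nn_integral_exp_neg_potential_finite:
  assumes "admissible_potential g g'"
  shows "(\<integral>\<^sup>+z. ennreal (exp (- g (cmod z))) \<partial>lborel) < \<infinity>"
proof -
  obtain C where C: "C \<ge> 0" "\<And>r. r \<ge> 0 \<Longrightarrow> exp (- g r) \<le> C / (1 + r) ^ 4"
    using exp_neg_potential_decay[OF assms] by blast
  have "(\<integral>\<^sup>+z. ennreal (exp (- g (cmod z))) \<partial>lborel)
      \<le> (\<integral>\<^sup>+z. ennreal C * ennreal (1 / (1 + cmod z) ^ 4) \<partial>lborel)"
    using C by (intro nn_integral_mono) (simp add: ennreal_mult'[symmetric] ennreal_leI)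
  also have "\<dots> = ennreal C * (\<integral>\<^sup>+z. ennreal (1 / (1 + cmod z) ^ 4) \<partial>lborel)"
    by (intro nn_integral_cmult) measurable
  also have "\<dots> < \<infinity>"
    using nn_integral_inverse_fourth_power_complex by (simp add: ennreal_mult_less_top)
  finally show ?thesis .
qed

lemma linear_growth_bounded_by_potential:
  assumes adm: "admissible_potential g g'"
  obtains C where "C \<ge> 1" "\<And>r. r \<ge> 0 \<Longrightarrow> (1 + r) * exp (- g r / 2) \<le> C"
proof -
  note g = admissible_potentialD[OF adm]
  have "eventually (\<lambda>r. r * exp (- g r / 2) < 1) at_top"
    using g(3) by (rule order_tendstoD) simp
  then obtain r0 where r0: "\<And>r. r \<ge> r0 \<Longrightarrow> r * exp (- g r / 2) < 1"
    by (auto simp: eventually_at_top_linorder)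
  show ?thesis
  proof (rule that[of "2 + \<bar>r0\<bar>"])
    fix r :: real assume r: "r \<ge> 0"
    have e1: "exp (- g r / 2) \<le> 1" using g(1)[OF r] by simp
    have "r * exp (- g r / 2) \<le> 1 + \<bar>r0\<bar>"
    proof (cases "r \<ge> r0")
      case True
      then show ?thesis using r0[of r] by linarith
    next
      case False
      have "r * exp (- g r / 2) \<le> r * 1" using e1 r by (intro mult_left_mono) auto
      then show ?thesis using False by linarith
    qed
    then show "(1 + r) * exp (- g r / 2) \<le> 2 + \<bar>r0\<bar>"
      using e1 unfolding distrib_right by linarith
  qed simp
qed

lemma prod_pairs:
  fixes a :: "nat \<Rightarrow> 'a::comm_monoid_mult"
  shows "(\<Prod>j<n. \<Prod>i<j. a i * a j) = (\<Prod>k<n. a k ^ (n - 1))"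
proof (induction n)
  case (Suc n)
  have "(\<Prod>j<Suc n. \<Prod>i<j. a i * a j)
      = (\<Prod>j<n. \<Prod>i<j. a i * a j) * ((\<Prod>k<n. a k) * a n ^ n)"
    by (simp only: prod.lessThan_Suc) (simp add: prod.distrib)
  also have "\<dots> = (\<Prod>k<n. a k ^ (n - 1) * a k) * a n ^ n"
    unfolding Suc by (simp add: prod.distrib mult.assoc)
  also have "(\<Prod>k<n. a k ^ (n - 1) * a k) = (\<Prod>k<n. a k ^ n)"
    by (intro prod.cong refl) (metis One_nat_def Suc_pred lessThan_iff mult.commute not_gr_zero not_less_zero power_Suc)
  finally show ?case by simp
qed simp

lemma measurable_lebesgue_n_component: "k < n \<Longrightarrow> (\<lambda>z. z k) \<in> borel_measurable (lebesgue_n n)"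
  unfolding lebesgue_n_def using measurable_component_singleton[of k "{..<n}" "\<lambda>_. lborel"] by simp

lemma measurable_ensemble_weight [measurable]:
  assumes "(\<lambda>z. g (cmod z)) \<in> borel_measurable borel"
  shows "ensemble_weight g n \<in> borel_measurable (lebesgue_n n)"
proof -
  note c = measurable_lebesgue_n_component
  have "(\<lambda>z. g (cmod (z k))) \<in> borel_measurable (lebesgue_n n)" if "k < n" for k
    using measurable_compose[OF c[OF that] assms] .
  then show ?thesis unfolding ensemble_weight_def[abs_def]
    by (intro borel_measurable_times borel_measurable_prod borel_measurable_power
        borel_measurable_diff c borel_measurable_norm[THEN measurable_compose[rotated]]
        borel_measurable_exp[THEN measurable_compose[rotated]] borel_measurable_const borel_measurable_sum)
       auto
qed

lemma ensemble_weight_nonneg: "ensemble_weight g n z \<ge> 0"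
  unfolding ensemble_weight_def by (intro mult_nonneg_nonneg prod_nonneg) auto

text \<open>
  By \<open>\<bar>z - w\<bar> \<le> (1 + \<bar>z\<bar>) (1 + \<bar>w\<bar>)\<close> the Vandermonde factor is at most
  \<open>\<Prod>\<^sub>k (1 + \<bar>z\<^sub>k\<bar>)\<^bsup>2(n-1)\<^esup>\<close>, which \<open>n - 1\<close> of the \<open>n\<close> copies of \<open>exp (- g)\<close> absorb up to a constant.
  The last copy provides integrability.
\<close>
lemma ensemble_weight_le:
  assumes C: "\<And>r. r \<ge> 0 \<Longrightarrow> (1 + r) * exp (- g r / 2) \<le> C" and "n > 0"
  shows "ensemble_weight g n z \<le> (\<Prod>k<n. C ^ (2 * (n - 1)) * exp (- g (cmod (z k))))"
proof -
  define a where "a k = (1 + cmod (z k))\<^sup>2" for k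
  have "(\<Prod>j<n. \<Prod>i<j. (cmod (z i - z j))\<^sup>2) \<le> (\<Prod>j<n. \<Prod>i<j. a i * a j)"
  proof (intro prod_mono conjI prod_nonneg zero_le_power2)
    fix i j
    have "cmod (z i - z j) \<le> (1 + cmod (z i)) * (1 + cmod (z j))"
      using norm_triangle_ineq4[of "z i" "z j"] mult_nonneg_nonneg[of "cmod (z i)" "cmod (z j)"]
        norm_ge_zero[of "z i"] norm_ge_zero[of "z j"]
      unfolding distrib_left distrib_right by linarith
    then show "(cmod (z i - z j))\<^sup>2 \<le> a i * a j"
      unfolding a_def power_mult_distrib[symmetric] by (intro power_mono) auto
  qed
  also have "\<dots> = (\<Prod>k<n. a k ^ (n - 1))" by (rule prod_pairs)
  finally have "ensemble_weight g n z
      \<le> (\<Prod>k<n. a k ^ (n - 1)) * exp (- real n * (\<Sum>k<n. g (cmod (z k))))"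
    unfolding ensemble_weight_def by (rule mult_right_mono) simp
  also have "exp (- real n * (\<Sum>k<n. g (cmod (z k)))) = (\<Prod>k<n. exp (- g (cmod (z k)) / 2) ^ (2 * (n - 1)) * exp (- g (cmod (z k))))"
  proof -
    have "exp (- real n * x) = exp (- x / 2) ^ (2 * (n - 1)) * exp (- x)" for x :: real
    proof -
      have "exp (- x / 2) ^ (2 * (n - 1)) * exp (- x) = exp (real (2 * (n - 1)) * (- x / 2) + - x)"
        by (simp only: exp_of_nat_mult exp_add)
      also have "real (2 * (n - 1)) * (- x / 2) + - x = - real n * x"
        using \<open>n > 0\<close> by (simp add: of_nat_diff algebra_simps)
      finally show ?thesis ..
    qed
    then show ?thesis by (simp only: sum_distrib_left exp_sum finite_lessThan)
  qed
  also have "(\<Prod>k<n. a k ^ (n - 1)) * \<dots>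
      = (\<Prod>k<n. ((1 + cmod (z k)) * exp (- g (cmod (z k)) / 2)) ^ (2 * (n - 1)) * exp (- g (cmod (z k))))"
    by (simp add: a_def prod.distrib[symmetric] power_mult power_mult_distrib mult.assoc)
  also have "\<dots> \<le> (\<Prod>k<n. C ^ (2 * (n - 1)) * exp (- g (cmod (z k))))"
    by (intro prod_mono conjI mult_right_mono power_mono C mult_nonneg_nonneg zero_le_power) auto
  finally show ?thesis .
qed

lemma nn_integral_ensemble_weight_le:
  assumes adm: "admissible_potential g g'" and cont: "continuous_on {0..} g"
  shows "\<exists>B\<ge>1. \<forall>n>0. (\<integral>\<^sup>+z. ennreal (ensemble_weight g n z) \<partial>lebesgue_n n) \<le> ennreal (B ^ (n * n))"
proof -
  obtain C where C: "C \<ge> 1" "\<And>r. r \<ge> 0 \<Longrightarrow> (1 + r) * exp (- g r / 2) \<le> C"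
    using linear_growth_bounded_by_potential[OF adm] by blast
  define A where "A = enn2real (\<integral>\<^sup>+z. ennreal (exp (- g (cmod z))) \<partial>lborel)"
  have A: "(\<integral>\<^sup>+z. ennreal (exp (- g (cmod z))) \<partial>lborel) = ennreal A" "A \<ge> 0"
    using nn_integral_exp_neg_potential_finite[OF adm] by (auto simp: A_def)
  define B where "B = C\<^sup>2 * (1 + A)"
  have B: "C\<^sup>2 \<le> B" "A \<le> B" "1 \<le> B"
  proof -
    have C2: "C\<^sup>2 \<ge> 1" using C(1) by simp
    then show "C\<^sup>2 \<le> B" using A(2) mult_left_mono[of 1 "1 + A" "C\<^sup>2"] by (simp add: B_def)
    then show "1 \<le> B" using C2 by linarith
    have "1 * (1 + A) \<le> C\<^sup>2 * (1 + A)" using A(2) C2 by (intro mult_right_mono) auto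
    then show "A \<le> B" by (simp add: B_def)
  qed
  note [measurable] = measurable_radial[OF cont]
  have le: "(\<integral>\<^sup>+z. ennreal (ensemble_weight g n z) \<partial>lebesgue_n n) \<le> ennreal (B ^ (n * n))"
    if n: "n > 0" for n
  proof -
    interpret product_sigma_finite "\<lambda>_::nat. lborel :: complex measure" by standard
    have "(\<integral>\<^sup>+z. ennreal (ensemble_weight g n z) \<partial>lebesgue_n n)
      \<le> (\<integral>\<^sup>+z. (\<Prod>k<n. ennreal (C ^ (2 * (n - 1)) * exp (- g (cmod (z k))))) \<partial>lebesgue_n n)"
      using ensemble_weight_le[OF C(2) n] C(1)
      by (intro nn_integral_mono) (subst prod_ennreal, auto intro!: ennreal_leI)
    also have "\<dots> = (\<Prod>k<n. \<integral>\<^sup>+z. ennreal (C ^ (2 * (n - 1)) * exp (- g (cmod z))) \<partial>lborel)"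
      unfolding lebesgue_n_def by (rule product_nn_integral_prod) auto
    also have "(\<integral>\<^sup>+z. ennreal (C ^ (2 * (n - 1)) * exp (- g (cmod z))) \<partial>lborel) = ennreal (C ^ (2 * (n - 1)) * A)"
      using C(1) A by (simp add: ennreal_mult nn_integral_cmult)
    also have "(\<Prod>k<n. ennreal (C ^ (2 * (n - 1)) * A)) = ennreal ((C ^ (2 * (n - 1)) * A) ^ n)"
      using A(2) C(1) by (simp add: ennreal_power)
    also have "\<dots> \<le> ennreal (B ^ (n * n))"
    proof (rule ennreal_leI)
      have "C ^ (2 * (n - 1)) * A \<le> B ^ (n - 1) * B"
        unfolding power_mult using B A(2) by (intro mult_mono power_mono) auto
      also have "\<dots> = B ^ n" using n by (metis One_nat_def Suc_pred mult.commute power_Suc)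
      finally show "(C ^ (2 * (n - 1)) * A) ^ n \<le> B ^ (n * n)"
        unfolding power_mult using A(2) C(1) by (intro power_mono) auto
    qed
    finally show ?thesis .
  qed
  then show ?thesis using B(3) by blast
qed

lemma ensemble_weight_integrable:
  assumes adm: "admissible_potential g g'" and cont: "continuous_on {0..} g" and n: "n > 0"
  shows "integrable (lebesgue_n n) (ensemble_weight g n)"
proof -
  obtain B where "(\<integral>\<^sup>+z. ennreal (ensemble_weight g n z) \<partial>lebesgue_n n) \<le> ennreal (B ^ (n * n))"
    using nn_integral_ensemble_weight_le[OF adm cont] n by blast
  then have "(\<integral>\<^sup>+z. ennreal (ensemble_weight g n z) \<partial>lebesgue_n n) < \<infinity>"
    using le_less_trans by fastforce
  then show ?thesis
    using measurable_ensemble_weight[OF measurable_radial[OF cont]]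
    by (intro integrableI_bounded) (auto simp: ensemble_weight_nonneg)
qed

lemma partition_fun_upper:
  assumes adm: "admissible_potential g g'" and cont: "continuous_on {0..} g"
  shows "\<exists>B\<ge>1. \<forall>n>0. partition_fun g n \<le> B ^ (n * n)"
proof -
  obtain B where B: "B \<ge> 1"
    "\<And>n. n > 0 \<Longrightarrow> (\<integral>\<^sup>+z. ennreal (ensemble_weight g n z) \<partial>lebesgue_n n) \<le> ennreal (B ^ (n * n))"
    using nn_integral_ensemble_weight_le[OF adm cont] by blast
  show ?thesis
  proof (intro exI[of _ B] conjI allI impI B(1))
    fix n :: nat assume n: "n > 0"
    have "ennreal (partition_fun g n) = (\<integral>\<^sup>+z. ennreal (ensemble_weight g n z) \<partial>lebesgue_n n)"
      unfolding partition_fun_def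
      by (rule nn_integral_eq_integral[symmetric, OF ensemble_weight_integrable[OF adm cont n]])
         (simp add: ensemble_weight_nonneg)
    then have "ennreal (partition_fun g n) \<le> ennreal (B ^ (n * n))" using B(2)[OF n] by simp
    then show "partition_fun g n \<le> B ^ (n * n)" by (subst (asm) ennreal_le_iff) (use B(1) in auto)
  qed
qed

section \<open>Measures with bounded density and their energy\<close>

text \<open>
  Borel probability measures on the plane with density at most \<open>M\<close> with respect to Lebesgue measure.
  The density itself is not needed, only the comparison of the two measures.
\<close>
definition bounded_density :: "real \<Rightarrow> complex measure \<Rightarrow> bool" where
  "bounded_density M \<nu> \<longleftrightarrow> prob_space \<nu> \<and> sets \<nu> = sets borel \<and> M > 0 \<and>
     (\<forall>A\<in>sets borel. emeasure \<nu> A \<le> ennreal M * emeasure lborel A)"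

text \<open>
  The logarithmic energy as a Bochner integral. It has its meaning only when the kernel is integrable
  and the diagonal is a null set: on the diagonal the integrand is \<open>- ln 0 = 0\<close>.
\<close>
definition log_energy :: "complex measure \<Rightarrow> real" where
  "log_energy \<nu> = (\<integral>p. - ln (cmod (fst p - snd p)) \<partial>(\<nu> \<Otimes>\<^sub>M \<nu>))"

lemma AE_pair_both:
  assumes "prob_space \<nu>" and "AE w in \<nu>. P w" and [measurable]: "Measurable.pred \<nu> P"
  shows "AE p in \<nu> \<Otimes>\<^sub>M \<nu>. P (fst p) \<and> P (snd p)"
proof -
  interpret prob_space \<nu> by fact
  interpret pair_sigma_finite \<nu> \<nu> ..
  show ?thesis
    by (rule AE_pair_measure) (use assms(2) in \<open>auto elim: eventually_mono\<close>)
qed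

text \<open>
  On a disc of radius \<open>R\<close> the shifted kernel \<open>ln (2 R / \<bar>z - w\<bar>)\<close> is nonnegative. This turns statements
  about the energy into statements about nonnegative integrals, to which Tonelli's theorem applies.
\<close>
lemma log_kernel_integrable:
  assumes \<nu>: "prob_space \<nu>" "sets \<nu> = sets borel" and R: "R > 0" "AE w in \<nu>. cmod w \<le> R"
    and fin: "(\<integral>\<^sup>+p. ennreal (ln (2 * R / cmod (fst p - snd p))) \<partial>(\<nu> \<Otimes>\<^sub>M \<nu>)) < \<infinity>"
    and offdiag: "AE p in \<nu> \<Otimes>\<^sub>M \<nu>. fst p \<noteq> snd p"
  shows "integrable (\<nu> \<Otimes>\<^sub>M \<nu>) (\<lambda>p. ln (cmod (fst p - snd p)))"
    and "(\<integral>\<^sup>+p. ennreal (ln (2 * R / cmod (fst p - snd p))) \<partial>(\<nu> \<Otimes>\<^sub>M \<nu>))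
           = ennreal (ln (2 * R) + log_energy \<nu>)"
    and "ln (2 * R) + log_energy \<nu> \<ge> 0"
proof -
  interpret prob_space \<nu> by fact
  interpret P: pair_prob_space \<nu> \<nu> ..
  note [measurable_cong] = \<nu>(2)
  define F where "F = (\<lambda>p::complex \<times> complex. ln (2 * R / cmod (fst p - snd p)))"
  have [measurable]: "F \<in> borel_measurable (\<nu> \<Otimes>\<^sub>M \<nu>)" unfolding F_def by measurable
  have ball: "AE p in \<nu> \<Otimes>\<^sub>M \<nu>. cmod (fst p) \<le> R \<and> cmod (snd p) \<le> R"
    by (rule AE_pair_both[OF \<nu>(1) R(2)]) measurable
  have F0: "AE p in \<nu> \<Otimes>\<^sub>M \<nu>. F p \<ge> 0"
    using ball offdiag
  proof eventually_elim
    case (elim p)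
    have "cmod (fst p - snd p) \<le> 2 * R" using norm_triangle_ineq4[of "fst p" "snd p"] elim by linarith
    then show ?case using elim unfolding F_def by (intro ln_ge_zero) simp
  qed
  have intF: "integrable (\<nu> \<Otimes>\<^sub>M \<nu>) F"
  proof (rule integrableI_bounded)
    have "(\<integral>\<^sup>+p. ennreal (norm (F p)) \<partial>(\<nu> \<Otimes>\<^sub>M \<nu>)) = (\<integral>\<^sup>+p. ennreal (F p) \<partial>(\<nu> \<Otimes>\<^sub>M \<nu>))"
      by (rule nn_integral_cong_AE) (use F0 in \<open>auto elim: eventually_mono\<close>)
    then show "(\<integral>\<^sup>+p. ennreal (norm (F p)) \<partial>(\<nu> \<Otimes>\<^sub>M \<nu>)) < \<infinity>" using fin by (simp add: F_def)
  qed measurable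
  have eq: "AE p in \<nu> \<Otimes>\<^sub>M \<nu>. ln (2 * R) - F p = ln (cmod (fst p - snd p))"
    using offdiag
  proof eventually_elim
    case (elim p)
    then show ?case using R by (simp add: F_def ln_div)
  qed
  have int2: "integrable (\<nu> \<Otimes>\<^sub>M \<nu>) (\<lambda>p. ln (2 * R) - F p)"
    using intF by simp
  show int: "integrable (\<nu> \<Otimes>\<^sub>M \<nu>) (\<lambda>p. ln (cmod (fst p - snd p)))"
    by (rule integrable_cong_AE_imp[OF int2]) (use eq in \<open>auto elim: eventually_mono\<close>)
  have "log_energy \<nu> = - (\<integral>p. ln (2 * R) - F p \<partial>(\<nu> \<Otimes>\<^sub>M \<nu>))"
    unfolding log_energy_def Bochner_Integration.integral_minus
    by (rule arg_cong[where f = uminus], rule integral_cong_AE) (use eq in \<open>auto elim: eventually_mono\<close>)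
  then have *: "ln (2 * R) + log_energy \<nu> = (\<integral>p. F p \<partial>(\<nu> \<Otimes>\<^sub>M \<nu>))"
    using intF by (simp add: P.prob_space)
  have "(\<integral>\<^sup>+p. ennreal (F p) \<partial>(\<nu> \<Otimes>\<^sub>M \<nu>)) = ennreal (\<integral>p. F p \<partial>(\<nu> \<Otimes>\<^sub>M \<nu>))"
    by (rule nn_integral_eq_integral[OF intF F0])
  then show "(\<integral>\<^sup>+p. ennreal (ln (2 * R / cmod (fst p - snd p))) \<partial>(\<nu> \<Otimes>\<^sub>M \<nu>))
           = ennreal (ln (2 * R) + log_energy \<nu>)" by (simp add: F_def *)
  show "ln (2 * R) + log_energy \<nu> \<ge> 0" unfolding * by (rule integral_nonneg_AE[OF F0])
qed

lemma bounded_density_offdiag: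
  assumes "bounded_density M \<nu>"
  shows "AE p in \<nu> \<Otimes>\<^sub>M \<nu>. fst p \<noteq> snd p"
proof -
  have \<nu>: "prob_space \<nu>" "sets \<nu> = sets borel" "M > 0"
    and le: "\<And>A. A \<in> sets borel \<Longrightarrow> emeasure \<nu> A \<le> ennreal M * emeasure lborel A"
    using assms by (auto simp: bounded_density_def)
  interpret prob_space \<nu> by fact
  interpret P: pair_prob_space \<nu> \<nu> ..
  note [measurable_cong] = \<nu>(2)
  have "AE w in \<nu>. z \<noteq> w" for z
  proof -
    have "emeasure \<nu> {z} = 0" using le[of "{z}"] by simp
    then have "{z} \<in> null_sets \<nu>" using \<nu>(2) by (auto simp: null_sets_def)
    from AE_not_in[OF this] show ?thesis by (auto elim: eventually_mono)
  qed
  then have "AE z in \<nu>. AE w in \<nu>. cmod (fst (z, w) - snd (z, w)) \<noteq> 0" by auto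
  then have "AE p in \<nu> \<Otimes>\<^sub>M \<nu>. cmod (fst p - snd p) \<noteq> 0"
    by (rule P.AE_pair_measure[rotated]) measurable
  then show ?thesis by (auto elim: eventually_mono)
qed

lemma bounded_density_kernel_finite:
  assumes \<nu>: "bounded_density M \<nu>" and R: "R > 0"
  shows "(\<integral>\<^sup>+p. ennreal (ln (2 * R / cmod (fst p - snd p))) \<partial>(\<nu> \<Otimes>\<^sub>M \<nu>)) < \<infinity>"
proof -
  have \<nu>': "prob_space \<nu>" "sets \<nu> = sets borel" using \<nu> by (auto simp: bounded_density_def)
  interpret prob_space \<nu> by fact
  interpret P: pair_prob_space \<nu> \<nu> ..
  note [measurable_cong] = \<nu>'(2)
  have "(\<integral>\<^sup>+p. ennreal (ln (2 * R / cmod (fst p - snd p))) \<partial>(\<nu> \<Otimes>\<^sub>M \<nu>))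
      = (\<integral>\<^sup>+z. \<integral>\<^sup>+w. ennreal (ln (2 * R / cmod (w - z))) \<partial>\<nu> \<partial>\<nu>)"
    by (subst nn_integral_fst[symmetric]) (auto simp: norm_minus_commute)
  also have "\<dots> \<le> (\<integral>\<^sup>+z. ennreal (ln (2 * R / (2 * R)) + M * (2 * pi * (2 * R)\<^sup>2)) \<partial>\<nu>)"
    using \<nu> R by (intro nn_integral_mono nn_integral_ln_bounded_density) (auto simp: bounded_density_def)
  also have "\<dots> < \<infinity>" by (simp add: emeasure_space_1)
  finally show ?thesis .
qed

lemma bounded_density_log_integrable:
  assumes \<nu>: "bounded_density M \<nu>" and R: "R > 0" "AE w in \<nu>. cmod w \<le> R"
  shows "integrable (\<nu> \<Otimes>\<^sub>M \<nu>) (\<lambda>p. ln (cmod (fst p - snd p)))"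
  using \<nu> by (intro log_kernel_integrable(1)[OF _ _ R bounded_density_kernel_finite[OF \<nu> R(1)] bounded_density_offdiag[OF \<nu>]])
    (auto simp: bounded_density_def)

section \<open>A lower bound by the inequality of Jensen\<close>

lemma distr_PiM_pair:
  assumes "prob_space \<nu>" "finite I" "i \<in> I" "j \<in> I" "i \<noteq> j"
  shows "distr (PiM I (\<lambda>_. \<nu>)) (\<nu> \<Otimes>\<^sub>M \<nu>) (\<lambda>x. (x i, x j)) = \<nu> \<Otimes>\<^sub>M \<nu>"
proof (rule pair_measure_eqI[symmetric])
  interpret prob_space \<nu> by fact
  interpret product_prob_space "\<lambda>_. \<nu>" I ..
  show "sigma_finite_measure \<nu>" "sigma_finite_measure \<nu>" by unfold_locales
  fix A B assume [measurable]: "A \<in> sets \<nu>" "B \<in> sets \<nu>"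
  have "emeasure (distr (PiM I (\<lambda>_. \<nu>)) (\<nu> \<Otimes>\<^sub>M \<nu>) (\<lambda>x. (x i, x j))) (A \<times> B)
      = emeasure (PiM I (\<lambda>_. \<nu>)) {x \<in> space (PiM I (\<lambda>_. \<nu>)). \<forall>k\<in>{i, j}. x k \<in> (if k = i then A else B)}"
    using assms by (subst emeasure_distr) (auto intro!: arg_cong2[where f = emeasure])
  also have "\<dots> = (\<Prod>k\<in>{i, j}. emeasure \<nu> (if k = i then A else B))"
    by (rule emeasure_PiM_Collect) (use assms in auto)
  also have "\<dots> = emeasure \<nu> A * emeasure \<nu> B" using assms by simp
  finally show "emeasure \<nu> A * emeasure \<nu> B
      = emeasure (distr (PiM I (\<lambda>_. \<nu>)) (\<nu> \<Otimes>\<^sub>M \<nu>) (\<lambda>x. (x i, x j))) (A \<times> B)" ..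
qed simp

text \<open>
  Comparison of measures passes to powers, in the form of an inequality between nonnegative integrals.
\<close>
lemma nn_integral_PiM_le_scaled:
  fixes N L :: "'a measure"
  assumes N: "sigma_finite_measure N" and L: "sigma_finite_measure L" and sets: "sets N = sets L"
    and le: "\<And>A. A \<in> sets L \<Longrightarrow> emeasure N A \<le> c * emeasure L A"
    and "f \<in> borel_measurable (PiM {..<n::nat} (\<lambda>_. L))"
  shows "(\<integral>\<^sup>+x. f x \<partial>PiM {..<n} (\<lambda>_. N)) \<le> c ^ n * (\<integral>\<^sup>+x. f x \<partial>PiM {..<n} (\<lambda>_. L))"
  using assms(5)
proof (induction n arbitrary: f)
  case 0
  interpret N: product_sigma_finite "\<lambda>_::nat. N" using N by (simp add: product_sigma_finite_def)
  interpret L: product_sigma_finite "\<lambda>_::nat. L" using L by (simp add: product_sigma_finite_def)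
  have "PiM {} (\<lambda>_::nat. N) = PiM {} (\<lambda>_. L)" by (simp add: PiM_empty)
  then show ?case by simp
next
  case (Suc n)
  interpret N: product_sigma_finite "\<lambda>_::nat. N" using N by (simp add: product_sigma_finite_def)
  interpret L: product_sigma_finite "\<lambda>_::nat. L" using L by (simp add: product_sigma_finite_def)
  interpret SL: sigma_finite_measure L by fact
  have ins: "{..<Suc n} = insert n {..<n}" by auto
  have setsP: "sets (PiM I (\<lambda>_. N)) = sets (PiM I (\<lambda>_. L))" for I :: "nat set"
    by (intro sets_PiM_cong sets refl)
  have f[measurable]: "f \<in> borel_measurable (PiM (insert n {..<n}) (\<lambda>_. L))" using Suc.prems ins by simp
  have fN: "f \<in> borel_measurable (PiM (insert n {..<n}) (\<lambda>_. N))"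
    using f setsP by (simp cong: measurable_cong_sets)
  have sec: "(\<lambda>y. f (x(n := y))) \<in> borel_measurable L" if x: "x \<in> space (PiM {..<n} (\<lambda>_. L))" for x
    by (rule measurable_compose[OF _ f]) (use x in \<open>auto intro!: measurable_fun_upd[where J = "{..<n}" and f = "\<lambda>_. x" and h = "\<lambda>y. y"]\<close>)
  have sp: "space (PiM {..<n} (\<lambda>_. N)) = space (PiM {..<n} (\<lambda>_. L))"
    using setsP by (rule sets_eq_imp_space_eq)
  have inner: "(\<lambda>x. \<integral>\<^sup>+y. f (x(n := y)) \<partial>L) \<in> borel_measurable (PiM {..<n} (\<lambda>_. L))"
    by measurable
  have "(\<integral>\<^sup>+x. f x \<partial>PiM {..<Suc n} (\<lambda>_. N)) = (\<integral>\<^sup>+x. \<integral>\<^sup>+y. f (x(n := y)) \<partial>N \<partial>PiM {..<n} (\<lambda>_. N))"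
    unfolding ins by (rule N.product_nn_integral_insert) (use fN in auto)
  also have "\<dots> \<le> (\<integral>\<^sup>+x. c * (\<integral>\<^sup>+y. f (x(n := y)) \<partial>L) \<partial>PiM {..<n} (\<lambda>_. N))"
    by (intro nn_integral_mono nn_integral_le_scaled[OF sets le]) (use sec sp in auto)
  also have "\<dots> = c * (\<integral>\<^sup>+x. (\<integral>\<^sup>+y. f (x(n := y)) \<partial>L) \<partial>PiM {..<n} (\<lambda>_. N))"
    by (rule nn_integral_cmult) (use inner setsP in \<open>simp cong: measurable_cong_sets\<close>)
  also have "\<dots> \<le> c * (c ^ n * (\<integral>\<^sup>+x. (\<integral>\<^sup>+y. f (x(n := y)) \<partial>L) \<partial>PiM {..<n} (\<lambda>_. L)))"
    by (intro mult_left_mono Suc.IH inner) simp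
  also have "(\<integral>\<^sup>+x. (\<integral>\<^sup>+y. f (x(n := y)) \<partial>L) \<partial>PiM {..<n} (\<lambda>_. L)) = (\<integral>\<^sup>+x. f x \<partial>PiM {..<Suc n} (\<lambda>_. L))"
    unfolding ins by (rule L.product_nn_integral_insert[symmetric]) (use f in auto)
  finally show ?case by (simp add: mult.assoc)
qed

lemma integrable_radial_potential:
  fixes g :: "real \<Rightarrow> real"
  assumes \<nu>: "prob_space \<nu>" "sets \<nu> = sets borel" and R: "AE w in \<nu>. cmod w \<le> R"
    and cont: "continuous_on {0..} g"
  shows "integrable \<nu> (\<lambda>w. g (cmod w))"
proof -
  interpret prob_space \<nu> by fact
  note [measurable_cong] = \<nu>(2)
  note [measurable] = measurable_radial[OF cont]
  have "compact (g ` {0..R})"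
    by (rule compact_continuous_image[OF continuous_on_subset[OF cont]]) auto
  then obtain B where B: "\<And>r. r \<in> {0..R} \<Longrightarrow> norm (g r) \<le> B"
    by (meson bounded_iff compact_imp_bounded image_eqI)
  show ?thesis
    by (rule integrable_const_bound[where B = B])
      (use R B in \<open>auto elim!: eventually_mono\<close>)
qed

text \<open>
  The configurations of \<open>n\<close> points without a point in \<open>U\<close>.
\<close>
definition hole_configs :: "nat \<Rightarrow> complex set \<Rightarrow> (nat \<Rightarrow> complex) set" where
  "hole_configs n U = {z \<in> space (lebesgue_n n). num_points n z U = 0}"

text \<open>
  The unnormalised hole probability: the integral of the weight over the configurations avoiding \<open>U\<close>.
\<close>
definition hole_integral :: "(real \<Rightarrow> real) \<Rightarrow> nat \<Rightarrow> complex set \<Rightarrow> real" where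
  "hole_integral g n U = (\<integral>z. indicator (hole_configs n U) z * ensemble_weight g n z \<partial>lebesgue_n n)"

lemma hole_configs_iff:
  "z \<in> hole_configs n U \<longleftrightarrow> z \<in> space (lebesgue_n n) \<and> (\<forall>k<n. z k \<notin> U)"
  unfolding hole_configs_def num_points_def by (auto simp: card_eq_0_iff)

lemma sets_hole_configs:
  assumes "U \<in> sets borel"
  shows "hole_configs n U \<in> sets (lebesgue_n n)"
proof -
  have "{z \<in> space (lebesgue_n n). \<forall>k\<in>{..<n}. z k \<in> - U} \<in> sets (lebesgue_n n)"
    using assms
    by (intro sets.sets_Collect_finite_All) 
       (auto intro!: measurable_sets_Collect[OF measurable_lebesgue_n_component] simp: pred_def)
  then show ?thesis
    by (rule back_subst[where P = "\<lambda>A. A \<in> _"]) (auto simp: hole_configs_iff)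
qed

text \<open>
  Let the points be independent with law \<open>\<nu>\<close>. As \<open>\<nu>\<close> has density at most \<open>M\<close> and does not charge \<open>U\<close>, the
  expected weight is at most \<open>M\<^sup>n\<close> times the integral over the configurations avoiding \<open>U\<close>. Jensen's
  inequality for \<open>exp\<close> bounds it below by the exponential of the expected logarithm of the weight, which
  consists of \<open>n (n - 1)\<close> copies of minus the energy and \<open>n\<^sup>2\<close> copies of minus the integral of the
  potential.
\<close>
lemma hole_integral_lower:
  assumes \<nu>: "bounded_density M \<nu>" and R: "R > 0" "AE w in \<nu>. cmod w \<le> R"
    and U: "U \<in> sets borel" "AE w in \<nu>. w \<notin> U"
    and cont: "continuous_on {0..} g" and int: "integrable (lebesgue_n n) (ensemble_weight g n)"
  shows "exp (- (real n * (real n - 1) * log_energy \<nu>) - (real n)\<^sup>2 * (\<integral>w. g (cmod w) \<partial>\<nu>))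
    \<le> M ^ n * hole_integral g n U"
proof -
  have \<nu>': "prob_space \<nu>" "sets \<nu> = sets borel" "M > 0"
    and le: "\<And>A. A \<in> sets borel \<Longrightarrow> emeasure \<nu> A \<le> ennreal M * emeasure lborel A"
    using \<nu> by (auto simp: bounded_density_def)
  interpret prob_space \<nu> by fact
  interpret P: product_prob_space "\<lambda>_. \<nu>" "{..<n}" ..
  note [measurable_cong] = \<nu>'(2)
  note [measurable] = measurable_radial[OF cont]
  define N where "N = PiM {..<n} (\<lambda>_. \<nu>)"
  interpret N: prob_space N unfolding N_def by (rule prob_space_PiM) (rule \<nu>'(1))
  have setsN: "sets N = sets (lebesgue_n n)"
    unfolding N_def lebesgue_n_def by (intro sets_PiM_cong refl) (simp add: \<nu>'(2))
  have comp [measurable]: "(\<lambda>z. z k) \<in> measurable N \<nu>" if "k < n" for k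
    unfolding N_def using measurable_component_singleton[of k "{..<n}" "\<lambda>_. \<nu>"] that by simp

  define L where "L i j z = ln (cmod (z i - z j))" for i j :: nat and z :: "nat \<Rightarrow> complex"
  have pair: "distr N (\<nu> \<Otimes>\<^sub>M \<nu>) (\<lambda>x. (x i, x j)) = \<nu> \<Otimes>\<^sub>M \<nu>" if "i < j" "j < n" for i j
    unfolding N_def using that by (intro distr_PiM_pair \<nu>'(1)) auto
  have pair_m: "(\<lambda>x. (x i, x j)) \<in> measurable N (\<nu> \<Otimes>\<^sub>M \<nu>)" if "i < j" "j < n" for i j
    using that by (intro measurable_Pair comp) auto
  have L: "integrable N (L i j)" "(\<integral>z. L i j z \<partial>N) = - log_energy \<nu>" "AE z in N. z i \<noteq> z j"
    if ij: "i < j" "j < n" for i j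
  proof -
    have "integrable (distr N (\<nu> \<Otimes>\<^sub>M \<nu>) (\<lambda>x. (x i, x j))) (\<lambda>p. ln (cmod (fst p - snd p)))"
      unfolding pair[OF ij] by (rule bounded_density_log_integrable[OF \<nu> R])
    from integrable_distr[OF pair_m[OF ij] this] show "integrable N (L i j)"
      by (simp add: L_def[abs_def])
    have "log_energy \<nu> = (\<integral>p. - ln (cmod (fst p - snd p)) \<partial>distr N (\<nu> \<Otimes>\<^sub>M \<nu>) (\<lambda>x. (x i, x j)))"
      unfolding log_energy_def pair[OF ij] ..
    also have "\<dots> = (\<integral>z. - L i j z \<partial>N)"
      by (subst integral_distr[OF pair_m[OF ij]]) (auto simp: L_def)
    finally show "(\<integral>z. L i j z \<partial>N) = - log_energy \<nu>" by simp
    have "AE p in distr N (\<nu> \<Otimes>\<^sub>M \<nu>) (\<lambda>x. (x i, x j)). fst p \<noteq> snd p"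
      unfolding pair[OF ij] by (rule bounded_density_offdiag[OF \<nu>])
    from AE_distrD[OF pair_m[OF ij] this] show "AE z in N. z i \<noteq> z j" by simp
  qed
  have single: "distr N \<nu> (\<lambda>x. x k) = \<nu>" if "k < n" for k
    unfolding N_def using that by (intro distr_PiM_component \<nu>'(1)) auto
  have G: "integrable N (\<lambda>z. g (cmod (z k)))" "(\<integral>z. g (cmod (z k)) \<partial>N) = (\<integral>w. g (cmod w) \<partial>\<nu>)"
    and notU: "AE z in N. z k \<notin> U" if k: "k < n" for k
  proof -
    have "integrable (distr N \<nu> (\<lambda>x. x k)) (\<lambda>w. g (cmod w))"
      unfolding single[OF k] by (rule integrable_radial_potential[OF \<nu>'(1,2) R(2) cont])
    from integrable_distr[OF comp[OF k] this] show "integrable N (\<lambda>z. g (cmod (z k)))" .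
    have "(\<integral>w. g (cmod w) \<partial>distr N \<nu> (\<lambda>x. x k)) = (\<integral>z. g (cmod (z k)) \<partial>N)"
      by (rule integral_distr[OF comp[OF k]]) measurable
    then show "(\<integral>z. g (cmod (z k)) \<partial>N) = (\<integral>w. g (cmod w) \<partial>\<nu>)" unfolding single[OF k] ..
    have "AE w in distr N \<nu> (\<lambda>x. x k). w \<notin> U" unfolding single[OF k] by (rule U(2))
    from AE_distrD[OF comp[OF k] this] show "AE z in N. z k \<notin> U" .
  qed

  \<comment> \<open>The logarithm of the weight; it is not the logarithm where two points coincide, which is a null event.\<close>
  define X where "X z = (\<Sum>j<n. \<Sum>i<j. 2 * L i j z) - real n * (\<Sum>k<n. g (cmod (z k)))" for z
  have intX: "integrable N X"
    unfolding X_def[abs_def]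
    by (intro Bochner_Integration.integrable_diff Bochner_Integration.integrable_sum
        Bochner_Integration.integrable_mult_right L G) auto
  have intL: "integrable N (\<lambda>z. \<Sum>i<j. 2 * L i j z)" if "j < n" for j
    using that by (intro Bochner_Integration.integrable_sum Bochner_Integration.integrable_mult_right L) auto
  have "(\<integral>z. (\<Sum>j<n. \<Sum>i<j. 2 * L i j z) \<partial>N) = (\<Sum>j<n. \<integral>z. (\<Sum>i<j. 2 * L i j z) \<partial>N)"
    by (rule Bochner_Integration.integral_sum) (use intL in auto)
  also have "\<dots> = (\<Sum>j<n. \<Sum>i<j. 2 * (\<integral>z. L i j z \<partial>N))"
    by (intro sum.cong refl, subst Bochner_Integration.integral_sum) (use L(1) in auto)
  finally have EL: "(\<integral>z. (\<Sum>j<n. \<Sum>i<j. 2 * L i j z) \<partial>N) = (\<Sum>j<n. \<Sum>i<j. 2 * (\<integral>z. L i j z \<partial>N))" .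
  have "(\<integral>z. X z \<partial>N) = (\<Sum>j<n. \<Sum>i<j. 2 * (\<integral>z. L i j z \<partial>N)) - real n * (\<Sum>k<n. \<integral>z. g (cmod (z k)) \<partial>N)"
    unfolding X_def[abs_def]
    using L(1) intL G(1)
    by (subst Bochner_Integration.integral_diff)
       (auto intro!: Bochner_Integration.integrable_sum simp: EL Bochner_Integration.integral_sum)
  also have "(\<Sum>j<n. \<Sum>i<j. 2 * (\<integral>z. L i j z \<partial>N)) = (\<Sum>j<n. \<Sum>i<j. 2 * - log_energy \<nu>)"
    by (intro sum.cong refl) (simp add: L(2))
  also have "\<dots> = - (real n * (real n - 1) * log_energy \<nu>)"
    by (induction n) (auto simp: algebra_simps)
  also have "(\<Sum>k<n. \<integral>z. g (cmod (z k)) \<partial>N) = real n * (\<integral>w. g (cmod w) \<partial>\<nu>)"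
    by (simp add: G(2))
  finally have EX: "N.expectation X
      = - (real n * (real n - 1) * log_energy \<nu>) - (real n)\<^sup>2 * (\<integral>w. g (cmod w) \<partial>\<nu>)"
    by (simp add: power2_eq_square mult.assoc)

  have wm: "ensemble_weight g n \<in> borel_measurable (lebesgue_n n)" by measurable
  have Hm: "hole_configs n U \<in> sets (lebesgue_n n)" by (rule sets_hole_configs[OF U(1)])
  define W where "W = (\<lambda>z. indicator (hole_configs n U) z * ensemble_weight g n z)"
  have Wm: "W \<in> borel_measurable (lebesgue_n n)" unfolding W_def using wm Hm by measurable
  have WmN: "W \<in> borel_measurable N" using Wm setsN by (simp cong: measurable_cong_sets)
  have W0: "W z \<ge> 0" for z unfolding W_def by (auto simp: ensemble_weight_nonneg indicator_def)
  have "AE z in N. \<forall>j\<in>{..<n}. \<forall>i\<in>{..<j}. z i \<noteq> z j"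
    using L(3) by (intro AE_finite_allI) auto
  moreover have "AE z in N. \<forall>k\<in>{..<n}. z k \<notin> U"
    using notU by (intro AE_finite_allI) auto
  moreover have "AE z in N. z \<in> space N" by (rule AE_space)
  ultimately have expX: "AE z in N. exp (X z) = W z"
  proof eventually_elim
    case (elim z)
    have "z \<in> hole_configs n U"
      using elim sets_eq_imp_space_eq[OF setsN] by (auto simp: hole_configs_iff)
    moreover have "exp (2 * L i j z) = (cmod (z i - z j))\<^sup>2" if "i < j" "j < n" for i j
    proof -
      have "z i \<noteq> z j" using elim that by auto
      then show ?thesis by (simp add: L_def exp_double)
    qed
    ultimately show ?case
      by (simp add: W_def X_def ensemble_weight_def exp_diff exp_sum exp_minus divide_inverse)
  qed
  have intW: "integrable (lebesgue_n n) W"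
    unfolding W_def using int Hm by (simp add: integrable_mult_indicator mult.commute integrable_real_mult_indicator)
  have Wle: "(\<integral>\<^sup>+z. ennreal (W z) \<partial>N) \<le> ennreal (M ^ n * hole_integral g n U)"
  proof -
    have "(\<integral>\<^sup>+z. ennreal (W z) \<partial>N) \<le> ennreal M ^ n * (\<integral>\<^sup>+z. ennreal (W z) \<partial>lebesgue_n n)"
      unfolding N_def lebesgue_n_def
      by (rule nn_integral_PiM_le_scaled)
         (use \<nu>' le Wm sigma_finite_measure_axioms sigma_finite_lborel in \<open>auto simp: lebesgue_n_def\<close>)
    also have "(\<integral>\<^sup>+z. ennreal (W z) \<partial>lebesgue_n n) = ennreal (hole_integral g n U)"
      unfolding hole_integral_def W_def[symmetric, THEN fun_cong]
      by (rule nn_integral_eq_integral[OF intW]) (simp add: W0)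
    also have "ennreal M ^ n * \<dots> = ennreal (M ^ n * hole_integral g n U)"
      using \<nu>'(3) by (simp add: ennreal_mult' ennreal_power)
    finally show ?thesis .
  qed
  have intWN: "integrable N W"
  proof (rule integrableI_bounded[OF WmN])
    have "(\<integral>\<^sup>+z. ennreal (W z) \<partial>N) < \<infinity>" using Wle le_less_trans by fastforce
    then show "(\<integral>\<^sup>+z. ennreal (norm (W z)) \<partial>N) < \<infinity>" by (simp add: W0)
  qed
  have intexp: "integrable N (\<lambda>z. exp (X z))"
    by (rule integrable_cong_AE_imp[OF intWN])
       (use intX expX in \<open>auto elim!: eventually_mono\<close>)
  have "exp (N.expectation X) \<le> N.expectation (\<lambda>z. exp (X z))"
    by (rule N.jensens_inequality[OF intX, where I = UNIV])
       (use intexp exp_convex in auto)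
  also have "N.expectation (\<lambda>z. exp (X z)) = N.expectation W"
    by (rule integral_cong_AE) (use intX intWN expX in auto)
  also have "\<dots> \<le> M ^ n * hole_integral g n U"
  proof -
    have "ennreal (N.expectation W) = (\<integral>\<^sup>+z. ennreal (W z) \<partial>N)"
      by (rule nn_integral_eq_integral[OF intWN, symmetric]) (simp add: W0)
    then have "ennreal (N.expectation W) \<le> ennreal (M ^ n * hole_integral g n U)" using Wle by simp
    moreover have "hole_integral g n U \<ge> 0"
      unfolding hole_integral_def using W0 by (auto intro!: integral_nonneg_AE simp: W_def)
    ultimately show ?thesis using \<nu>'(3) by (subst (asm) ennreal_le_iff) auto
  qed
  finally show ?thesis unfolding EX .
qed

section \<open>Measures of finite weighted energy\<close>

lemma AE_in_measure_support:
  fixes \<mu> :: "'a::second_countable_topology measure"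
  assumes "sets \<mu> = sets borel"
  shows "AE x in \<mu>. x \<in> measure_support \<mu>"
proof -
  define \<F> where "\<F> = {V. open V \<and> emeasure \<mu> V = 0}"
  obtain \<G> where \<G>: "\<G> \<subseteq> \<F>" "countable \<G>" "\<Union>\<G> = \<Union>\<F>"
    using Lindelof[of \<F>] unfolding \<F>_def by auto
  have null: "V \<in> null_sets \<mu>" if "V \<in> \<G>" for V
    using that \<G>(1) assms by (auto simp: \<F>_def null_sets_def)
  have "(\<Union>V\<in>\<G>. V) \<in> null_sets \<mu>"
    by (rule null_sets_UN'[OF \<G>(2)]) (rule null)
  then have "\<Union>\<F> \<in> null_sets \<mu>" using \<G>(3) by simp
  moreover have "\<Union>\<F> = - measure_support \<mu>"
    unfolding \<F>_def measure_support_def by auto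
  ultimately show ?thesis using AE_not_in[of "\<Union>\<F>" \<mu>] by simp
qed

lemma compact_prob_measuresD:
  assumes "\<mu> \<in> compact_prob_measures E"
  shows "prob_space \<mu>" "sets \<mu> = sets borel" "AE w in \<mu>. w \<in> E"
    and "\<exists>R>0. AE w in \<mu>. cmod w \<le> R"
proof -
  have \<mu>: "compact (measure_support \<mu>)" "measure_support \<mu> \<subseteq> E" and s: "sets \<mu> = sets borel"
    using assms by (auto simp: compact_prob_measures_def)
  show "prob_space \<mu>" "sets \<mu> = sets borel" using assms by (auto simp: compact_prob_measures_def)
  note ae = AE_in_measure_support[OF s]
  show "AE w in \<mu>. w \<in> E" using ae \<mu>(2) by (auto elim!: eventually_mono)
  obtain R where "R > 0" "\<And>w. w \<in> measure_support \<mu> \<Longrightarrow> cmod w \<le> R"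
    using \<mu>(1) compact_imp_bounded bounded_pos by metis
  then show "\<exists>R>0. AE w in \<mu>. cmod w \<le> R" using ae by (auto elim!: eventually_mono)
qed

text \<open>
  For a measure of bounded support and finite weighted energy the extended-real integral is an ordinary
  one. The value \<open>\<infinity>\<close> of the kernel on the diagonal forces the diagonal to be a null set.
\<close>
lemma finite_weighted_energy:
  assumes \<mu>: "prob_space \<mu>" "sets \<mu> = sets borel" and R: "R > 0" "AE w in \<mu>. cmod w \<le> R"
    and fin: "weighted_energy g \<mu> \<noteq> \<infinity>"
  shows "AE p in \<mu> \<Otimes>\<^sub>M \<mu>. fst p \<noteq> snd p"
    and "(\<integral>\<^sup>+p. ennreal (ln (2 * R / cmod (fst p - snd p))) \<partial>(\<mu> \<Otimes>\<^sub>M \<mu>)) < \<infinity>"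
    and "weighted_energy g \<mu> = ereal (log_energy \<mu> + (\<integral>w. g (cmod w) \<partial>\<mu>))"
proof -
  interpret prob_space \<mu> by fact
  interpret P: pair_prob_space \<mu> \<mu> ..
  note [measurable_cong] = \<mu>(2)
  define f where "f = (\<lambda>p::complex \<times> complex. - ereal_ln (cmod (fst p - snd p)))"
  have [measurable]: "f \<in> borel_measurable (\<mu> \<Otimes>\<^sub>M \<mu>)" unfolding f_def ereal_ln_def by measurable
  define A where "A = (\<integral>\<^sup>+p. e2ennreal (f p) \<partial>(\<mu> \<Otimes>\<^sub>M \<mu>))"
  define B where "B = (\<integral>\<^sup>+p. e2ennreal (- f p) \<partial>(\<mu> \<Otimes>\<^sub>M \<mu>))"
  have energy: "weighted_energy g \<mu> = (enn2ereal A - enn2ereal B) + ereal (\<integral>w. g (cmod w) \<partial>\<mu>)"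
    unfolding weighted_energy_def ereal_integral_def A_def B_def f_def by (simp add: case_prod_beta)
  have "AE p in \<mu> \<Otimes>\<^sub>M \<mu>. cmod (fst p) \<le> R \<and> cmod (snd p) \<le> R"
    by (rule AE_pair_both[OF \<mu>(1) R(2)]) measurable
  then have "AE p in \<mu> \<Otimes>\<^sub>M \<mu>. e2ennreal (- f p) \<le> ennreal (ln (2 * R))"
  proof eventually_elim
    case (elim p)
    show ?case
    proof (cases "fst p = snd p")
      case True
      then show ?thesis by (simp add: f_def ereal_ln_def e2ennreal_neg)
    next
      case False
      have "cmod (fst p - snd p) \<le> 2 * R" using norm_triangle_ineq4[of "fst p" "snd p"] elim by linarith
      then have "ln (cmod (fst p - snd p)) \<le> ln (2 * R)" using False by (intro ln_mono) auto
      then show ?thesis using False by (simp add: f_def ereal_ln_def ennreal_leI)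
    qed
  qed
  then have "B \<le> (\<integral>\<^sup>+p. ennreal (ln (2 * R)) \<partial>(\<mu> \<Otimes>\<^sub>M \<mu>))"
    unfolding B_def by (rule nn_integral_mono_AE)
  then have B: "B < \<top>" using le_less_trans[of B "ennreal (ln (2 * R))" \<top>] by (simp add: P.emeasure_space_1)
  have A: "A < \<top>"
  proof (rule ccontr)
    assume "\<not> A < \<top>"
    then have "A = \<top>" using top.not_eq_extremum by blast
    moreover obtain b where "B = ennreal b" "b \<ge> 0" using B by (cases B) auto
    ultimately show False using fin unfolding energy by (simp add: enn2ereal_ennreal)
  qed
  have "AE p in \<mu> \<Otimes>\<^sub>M \<mu>. e2ennreal (f p) \<noteq> \<top>"
    using nn_integral_PInf_AE[of "\<lambda>p. e2ennreal (f p)" "\<mu> \<Otimes>\<^sub>M \<mu>"] A unfolding A_def by auto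
  then show off: "AE p in \<mu> \<Otimes>\<^sub>M \<mu>. fst p \<noteq> snd p"
    by eventually_elim (auto simp: f_def ereal_ln_def)
  have A': "A = (\<integral>\<^sup>+p. ennreal (- ln (cmod (fst p - snd p))) \<partial>(\<mu> \<Otimes>\<^sub>M \<mu>))"
    unfolding A_def by (rule nn_integral_cong_AE)
      (use off in \<open>eventually_elim, auto simp: f_def ereal_ln_def\<close>)
  have B': "B = (\<integral>\<^sup>+p. ennreal (ln (cmod (fst p - snd p))) \<partial>(\<mu> \<Otimes>\<^sub>M \<mu>))"
    unfolding B_def by (rule nn_integral_cong_AE)
      (use off in \<open>eventually_elim, auto simp: f_def ereal_ln_def\<close>)
  have "(\<integral>\<^sup>+p. ennreal (ln (2 * R / cmod (fst p - snd p))) \<partial>(\<mu> \<Otimes>\<^sub>M \<mu>))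
      \<le> (\<integral>\<^sup>+p. ennreal \<bar>ln (2 * R)\<bar> + ennreal (- ln (cmod (fst p - snd p))) \<partial>(\<mu> \<Otimes>\<^sub>M \<mu>))"
  proof (rule nn_integral_mono_AE, use off in eventually_elim)
    fix p :: "complex \<times> complex" assume "fst p \<noteq> snd p"
    then have "ln (2 * R / cmod (fst p - snd p)) \<le> \<bar>ln (2 * R)\<bar> + - ln (cmod (fst p - snd p))"
      using R by (simp add: ln_div)
    then have "ennreal (ln (2 * R / cmod (fst p - snd p)))
      \<le> ennreal (\<bar>ln (2 * R)\<bar> + - ln (cmod (fst p - snd p)))" by (rule ennreal_leI)
    also have "\<dots> \<le> ennreal \<bar>ln (2 * R)\<bar> + ennreal (- ln (cmod (fst p - snd p)))"
      by (cases "ln (cmod (fst p - snd p)) \<le> 0")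
         (auto simp: ennreal_neg ennreal_leI simp flip: ennreal_plus)
    finally show "ennreal (ln (2 * R / cmod (fst p - snd p)))
      \<le> ennreal \<bar>ln (2 * R)\<bar> + ennreal (- ln (cmod (fst p - snd p)))" .
  qed
  also have "\<dots> = ennreal \<bar>ln (2 * R)\<bar> + A"
    unfolding A' by (subst nn_integral_add) (auto simp: P.emeasure_space_1)
  also have "\<dots> < \<infinity>" using A by simp
  finally show fin': "(\<integral>\<^sup>+p. ennreal (ln (2 * R / cmod (fst p - snd p))) \<partial>(\<mu> \<Otimes>\<^sub>M \<mu>)) < \<infinity>" .
  have int: "integrable (\<mu> \<Otimes>\<^sub>M \<mu>) (\<lambda>p. - ln (cmod (fst p - snd p)))"
    using log_kernel_integrable(1)[OF \<mu> R fin' off] by simp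
  have "log_energy \<mu> = enn2real A - enn2real B"
    unfolding log_energy_def real_lebesgue_integral_def[OF int] A' B' by simp
  moreover have "enn2ereal A - enn2ereal B = ereal (enn2real A - enn2real B)"
    using A B by (cases A; cases B) (auto simp: enn2ereal_ennreal)
  ultimately show "weighted_energy g \<mu> = ereal (log_energy \<mu> + (\<integral>w. g (cmod w) \<partial>\<mu>))"
    unfolding energy by simp
qed

section \<open>Exterior discs at a small scale\<close>

text \<open>
  Every point outside \<open>U\<close>, not only of the boundary, is within \<open>2 \<delta>\<close> of the centre of a disc of radius
  \<open>\<delta>\<close> outside \<open>U\<close>. If the disc around the point itself meets the boundary, an exterior disc of radius
  \<open>\<epsilon>\<close> at such a boundary point is shrunk towards that point.
\<close>
lemma exterior_ball_all_scales:
  fixes U :: "complex set"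
  assumes "open U" "exterior_ball_condition U"
  obtains \<epsilon> where "\<epsilon> > 0"
    "\<And>\<delta> z. 0 < \<delta> \<Longrightarrow> \<delta> \<le> \<epsilon> \<Longrightarrow> z \<notin> U \<Longrightarrow> \<exists>\<eta>. ball \<eta> \<delta> \<subseteq> - U \<and> cmod (\<eta> - z) \<le> 2 * \<delta>"
proof -
  obtain \<epsilon> where \<epsilon>: "\<epsilon> > 0"
    and ext: "\<And>p. p \<in> frontier U \<Longrightarrow> \<exists>\<eta>\<in>- U. ball \<eta> \<epsilon> \<subseteq> - U \<and> cmod (p - \<eta>) = \<epsilon>"
    using assms(2) unfolding exterior_ball_condition_def by auto
  show ?thesis
  proof (rule that[OF \<epsilon>])
    fix \<delta> :: real and z assume \<delta>: "0 < \<delta>" "\<delta> \<le> \<epsilon>" and z: "z \<notin> U"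
    show "\<exists>\<eta>. ball \<eta> \<delta> \<subseteq> - U \<and> cmod (\<eta> - z) \<le> 2 * \<delta>"
    proof (cases "ball z \<delta> \<inter> frontier U = {}")
      case True
      have "ball z \<delta> \<inter> U = {}"
      proof (rule ccontr)
        assume "ball z \<delta> \<inter> U \<noteq> {}"
        moreover have "z \<in> ball z \<delta> - U" using z \<delta> by simp
        ultimately show False using connected_Int_frontier[of "ball z \<delta>" U] True by blast
      qed
      then show ?thesis using \<delta> by (intro exI[of _ z]) auto
    next
      case False
      then obtain p where p: "p \<in> frontier U" "cmod (p - z) < \<delta>"
        by (auto simp: dist_norm norm_minus_commute)
      obtain c where c: "ball c \<epsilon> \<subseteq> - U" "cmod (p - c) = \<epsilon>" using ext[OF p(1)] by auto
      define \<eta> where "\<eta> = p + of_real (\<delta> / \<epsilon>) * (c - p)"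
      have "cmod (\<eta> - p) = \<delta>"
        using c(2) \<epsilon> \<delta> unfolding \<eta>_def add_diff_cancel_left' norm_mult norm_of_real
        by (simp add: norm_minus_commute)
      then have "cmod (\<eta> - z) \<le> 2 * \<delta>" using norm_triangle_ineq[of "\<eta> - p" "p - z"] p(2) by simp
      moreover have "ball \<eta> \<delta> \<subseteq> ball c \<epsilon>"
      proof -
        have "c - \<eta> = of_real (1 - \<delta> / \<epsilon>) * (c - p)" by (simp add: \<eta>_def algebra_simps)
        then have "cmod (c - \<eta>) = \<bar>1 - \<delta> / \<epsilon>\<bar> * \<epsilon>"
          using c(2) by (simp only: norm_mult norm_of_real) (simp add: norm_minus_commute)
        also have "\<dots> = \<epsilon> - \<delta>" using \<epsilon> \<delta> by (simp add: field_simps)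
        finally have "dist c \<eta> = \<epsilon> - \<delta>" by (simp add: dist_norm)
        then show ?thesis
        proof (intro subsetI)
          fix x assume "x \<in> ball \<eta> \<delta>"
          then show "x \<in> ball c \<epsilon>" using dist_triangle[of c x \<eta>] \<open>dist c \<eta> = \<epsilon> - \<delta>\<close> by simp
        qed
      qed
      ultimately show ?thesis using c(1) by blast
    qed
  qed
qed

text \<open>
  The centres can be chosen to depend measurably on the point, at the cost of a larger distance: the
  choice is made constant on the cells of a square grid of mesh \<open>\<delta>\<close>, of which there are countably many.
\<close>
lemma measurable_ball_centres:
  fixes S :: "complex set"
  assumes "\<delta> > 0" and ex: "\<And>z. z \<in> S \<Longrightarrow> \<exists>\<eta>. ball \<eta> \<delta> \<subseteq> S \<and> cmod (\<eta> - z) \<le> 2 * \<delta>"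
  obtains \<eta> where "\<eta> \<in> measurable borel borel"
    "\<And>z. z \<in> S \<Longrightarrow> ball (\<eta> z) \<delta> \<subseteq> S" "\<And>z. z \<in> S \<Longrightarrow> cmod (\<eta> z - z) \<le> 4 * \<delta>"
proof -
  define cell where "cell a b = {z \<in> S. \<lfloor>Re z / \<delta>\<rfloor> = a \<and> \<lfloor>Im z / \<delta>\<rfloor> = b}" for a b
  define rep where "rep a b = (SOME z. z \<in> cell a b)" for a b
  obtain c where c: "\<And>z. z \<in> S \<Longrightarrow> ball (c z) \<delta> \<subseteq> S \<and> cmod (c z - z) \<le> 2 * \<delta>"
    using ex by metis
  define \<eta> where "\<eta> z = c (rep \<lfloor>Re z / \<delta>\<rfloor> \<lfloor>Im z / \<delta>\<rfloor>)" for z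
  show ?thesis
  proof (rule that[of \<eta>])
    have "(\<lambda>z. c (rep a \<lfloor>Im z / \<delta>\<rfloor>)) \<in> measurable borel borel" for a
      by (rule measurable_compose_countable[where f = "\<lambda>b z. c (rep a b)"]) measurable
    then show "\<eta> \<in> measurable borel borel"
      unfolding \<eta>_def[abs_def]
      by (rule measurable_compose_countable[where f = "\<lambda>a z. c (rep a \<lfloor>Im z / \<delta>\<rfloor>)"]) measurable
    fix z assume z: "z \<in> S"
    define y where "y = rep \<lfloor>Re z / \<delta>\<rfloor> \<lfloor>Im z / \<delta>\<rfloor>"
    have "z \<in> cell \<lfloor>Re z / \<delta>\<rfloor> \<lfloor>Im z / \<delta>\<rfloor>" using z by (simp add: cell_def)
    then have y: "y \<in> S" "\<lfloor>Re y / \<delta>\<rfloor> = \<lfloor>Re z / \<delta>\<rfloor>" "\<lfloor>Im y / \<delta>\<rfloor> = \<lfloor>Im z / \<delta>\<rfloor>"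
      unfolding y_def rep_def using someI[of "\<lambda>x. x \<in> cell _ _" z] by (auto simp: cell_def)
    have close: "\<bar>s - t\<bar> \<le> \<delta>" if "\<lfloor>s / \<delta>\<rfloor> = \<lfloor>t / \<delta>\<rfloor>" for s t
    proof -
      have "\<bar>s / \<delta> - t / \<delta>\<bar> \<le> 1" using that by linarith
      then show ?thesis using \<open>\<delta> > 0\<close> by (simp add: abs_le_iff field_simps)
    qed
    have "cmod (y - z) \<le> \<bar>Re (y - z)\<bar> + \<bar>Im (y - z)\<bar>" by (rule cmod_le)
    also have "\<dots> \<le> 2 * \<delta>" using close[OF y(2)] close[OF y(3)] by simp
    finally have "cmod (y - z) \<le> 2 * \<delta>" .
    moreover have "\<eta> z = c y" by (simp add: \<eta>_def y_def)
    ultimately show "ball (\<eta> z) \<delta> \<subseteq> S" "cmod (\<eta> z - z) \<le> 4 * \<delta>"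
      using c[OF y(1)] norm_triangle_ineq[of "c y - y" "y - z"] by auto
  qed
qed

section \<open>Smearing a measure over exterior discs\<close>

text \<open>
  The law of a uniformly distributed point of the disc \<open>ball (\<eta> z) \<delta>\<close>, where \<open>z\<close> has law \<open>\<mu>\<close>, written
  down through its density.
\<close>
definition smear :: "real \<Rightarrow> (complex \<Rightarrow> complex) \<Rightarrow> complex measure \<Rightarrow> complex measure" where
  "smear \<delta> \<eta> \<mu> = density lborel
     (\<lambda>w. \<integral>\<^sup>+z. indicator (ball (\<eta> z) \<delta>) w / emeasure lborel (ball (\<eta> z) \<delta>) \<partial>\<mu>)"

text \<open>
  The uniform distribution on the disc of radius \<open>\<delta>\<close> around \<open>c\<close>.
\<close>
abbreviation disc_measure :: "real \<Rightarrow> complex \<Rightarrow> complex measure" where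
  "disc_measure \<delta> c \<equiv> uniform_measure lborel (ball c \<delta>)"

lemma bounded_density_disc:
  assumes "\<delta> > 0"
  shows "bounded_density (1 / (pi * \<delta>\<^sup>2)) (disc_measure \<delta> c)"
  unfolding bounded_density_def
proof (intro conjI ballI)
  have em: "emeasure lborel (ball c \<delta>) = ennreal (pi * \<delta>\<^sup>2)" "pi * \<delta>\<^sup>2 > 0"
    using assms by (auto simp: emeasure_complex_ball)
  show "prob_space (disc_measure \<delta> c)"
    by (rule prob_space_uniform_measure) (use em in auto)
  fix A :: "complex set" assume A: "A \<in> sets borel"
  have "emeasure (disc_measure \<delta> c) A = emeasure lborel (ball c \<delta> \<inter> A) / ennreal (pi * \<delta>\<^sup>2)"
    using A em by simp
  also have "\<dots> \<le> emeasure lborel A / ennreal (pi * \<delta>\<^sup>2)"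
    by (intro divide_right_mono_ennreal emeasure_mono) (use A in auto)
  also have "\<dots> = ennreal (1 / (pi * \<delta>\<^sup>2)) * emeasure lborel A"
    using em(2) by (simp add: divide_ennreal_def inverse_ennreal divide_inverse mult.commute)
  finally show "emeasure (disc_measure \<delta> c) A \<le> ennreal (1 / (pi * \<delta>\<^sup>2)) * emeasure lborel A" .
qed (use assms in simp_all)

lemma AE_disc_measure: "AE w in disc_measure \<delta> c. w \<in> ball c \<delta>"
  by (rule AE_uniform_measureI) auto

context
  fixes \<delta> :: real and \<eta> :: "complex \<Rightarrow> complex" and \<mu> :: "complex measure"
  assumes \<delta>: "\<delta> > 0" and \<eta> [measurable]: "\<eta> \<in> measurable borel borel"
    and \<mu>: "prob_space \<mu>" "sets \<mu> = sets borel"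
begin

lemma measurable_ball_indicator:
  "(\<lambda>p. indicator (ball (\<eta> (fst p)) \<delta>) (snd p) :: ennreal) \<in> borel_measurable (\<mu> \<Otimes>\<^sub>M lborel)"
proof -
  note [measurable_cong] = \<mu>(2)
  have "(\<lambda>p. indicator {p. dist (\<eta> (fst p)) (snd p) < \<delta>} p :: ennreal) \<in> borel_measurable (\<mu> \<Otimes>\<^sub>M lborel)"
    by measurable
  then show ?thesis by (simp add: indicator_def)
qed

lemma sets_smear: "sets (smear \<delta> \<eta> \<mu>) = sets borel"
  by (simp add: smear_def)

lemma nn_integral_smear:
  assumes F: "F \<in> borel_measurable borel"
  shows "(\<integral>\<^sup>+w. F w \<partial>smear \<delta> \<eta> \<mu>) = (\<integral>\<^sup>+z. (\<integral>\<^sup>+w. F w \<partial>disc_measure \<delta> (\<eta> z)) \<partial>\<mu>)"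
proof -
  interpret prob_space \<mu> by (rule \<mu>(1))
  interpret P: pair_sigma_finite \<mu> "lborel :: complex measure" ..
  note [measurable_cong] = \<mu>(2)
  note [measurable] = F
  define c where "c = ennreal (pi * \<delta>\<^sup>2)"
  have em: "emeasure lborel (ball x \<delta>) = c" for x :: complex
    using \<delta> by (simp add: emeasure_complex_ball c_def)
  have [measurable]: "(\<lambda>p. indicator (ball (\<eta> (fst p)) \<delta>) (snd p) :: ennreal) \<in> borel_measurable (\<mu> \<Otimes>\<^sub>M lborel)"
    by (rule measurable_ball_indicator)
  have m1: "(\<lambda>(z, w). indicator (ball (\<eta> z) \<delta>) w / c * F w) \<in> borel_measurable (\<mu> \<Otimes>\<^sub>M lborel)"
    unfolding case_prod_beta by measurable
  have dens: "(\<lambda>w. \<integral>\<^sup>+z. indicator (ball (\<eta> z) \<delta>) w / c \<partial>\<mu>) \<in> borel_measurable lborel"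
  proof -
    have "(\<lambda>(w, z). indicator (ball (\<eta> z) \<delta>) w / c) \<in> borel_measurable (lborel \<Otimes>\<^sub>M \<mu>)"
      using measurable_compose[OF measurable_pair_swap' measurable_ball_indicator]
      by (auto simp: case_prod_beta intro!: borel_measurable_divide_ennreal)
    then show ?thesis by measurable
  qed
  have sec: "(\<lambda>z. indicator (ball (\<eta> z) \<delta>) w / c :: ennreal) \<in> borel_measurable \<mu>" for w
    using measurable_compose[OF measurable_Pair1'[of w lborel \<mu>]] measurable_compose[OF measurable_Pair2'[of w lborel \<mu>] measurable_ball_indicator]
    by (auto intro!: borel_measurable_divide_ennreal)
  have "(\<integral>\<^sup>+w. F w \<partial>smear \<delta> \<eta> \<mu>)
      = (\<integral>\<^sup>+w. (\<integral>\<^sup>+z. indicator (ball (\<eta> z) \<delta>) w / c \<partial>\<mu>) * F w \<partial>lborel)"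
    unfolding smear_def em by (rule nn_integral_density) (use dens F in auto)
  also have "\<dots> = (\<integral>\<^sup>+w. (\<integral>\<^sup>+z. indicator (ball (\<eta> z) \<delta>) w / c * F w \<partial>\<mu>) \<partial>lborel)"
    by (intro nn_integral_cong nn_integral_multc[symmetric] sec)
  also have "\<dots> = (\<integral>\<^sup>+z. (\<integral>\<^sup>+w. indicator (ball (\<eta> z) \<delta>) w / c * F w \<partial>lborel) \<partial>\<mu>)"
    by (rule P.Fubini'[OF m1])
  also have "\<dots> = (\<integral>\<^sup>+z. (\<integral>\<^sup>+w. F w \<partial>disc_measure \<delta> (\<eta> z)) \<partial>\<mu>)"
  proof (rule nn_integral_cong)
    fix z
    have "(\<integral>\<^sup>+w. F w \<partial>disc_measure \<delta> (\<eta> z)) = (\<integral>\<^sup>+w. F w * indicator (ball (\<eta> z) \<delta>) w \<partial>lborel) / c"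
      by (subst nn_integral_uniform_measure) (use F em in auto)
    also have "\<dots> = (\<integral>\<^sup>+w. F w * indicator (ball (\<eta> z) \<delta>) w / c \<partial>lborel)"
      by (rule nn_integral_divide[symmetric])
         (use F in \<open>auto intro!: borel_measurable_times_ennreal borel_measurable_indicator\<close>)
    finally show "(\<integral>\<^sup>+w. indicator (ball (\<eta> z) \<delta>) w / c * F w \<partial>lborel) = (\<integral>\<^sup>+w. F w \<partial>disc_measure \<delta> (\<eta> z))"
      by (simp add: divide_ennreal_def mult_ac)
  qed
  finally show ?thesis .
qed

lemma emeasure_smear:
  assumes "A \<in> sets borel"
  shows "emeasure (smear \<delta> \<eta> \<mu>) A = (\<integral>\<^sup>+z. emeasure (disc_measure \<delta> (\<eta> z)) A \<partial>\<mu>)"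
  using nn_integral_smear[of "indicator A"] assms sets_smear by simp

lemma bounded_density_smear: "bounded_density (1 / (pi * \<delta>\<^sup>2)) (smear \<delta> \<eta> \<mu>)"
  unfolding bounded_density_def
proof (intro conjI ballI sets_smear)
  interpret prob_space \<mu> by (rule \<mu>(1))
  have disc: "emeasure (disc_measure \<delta> (\<eta> z)) UNIV = 1" for z
    using bounded_density_disc[OF \<delta>, of "\<eta> z"] prob_space.emeasure_space_1[of "disc_measure \<delta> (\<eta> z)"]
    by (simp add: bounded_density_def)
  show "prob_space (smear \<delta> \<eta> \<mu>)"
  proof
    have "space (smear \<delta> \<eta> \<mu>) = UNIV" by (simp add: smear_def)
    then show "emeasure (smear \<delta> \<eta> \<mu>) (space (smear \<delta> \<eta> \<mu>)) = 1"
      using emeasure_smear[of UNIV] emeasure_space_1 by (simp only: disc) simp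
  qed
  fix A :: "complex set" assume A: "A \<in> sets borel"
  have "emeasure (smear \<delta> \<eta> \<mu>) A \<le> (\<integral>\<^sup>+z. ennreal (1 / (pi * \<delta>\<^sup>2)) * emeasure lborel A \<partial>\<mu>)"
    unfolding emeasure_smear[OF A]
    using bounded_density_disc[OF \<delta>] A by (intro nn_integral_mono) (auto simp: bounded_density_def)
  also have "\<dots> = ennreal (1 / (pi * \<delta>\<^sup>2)) * emeasure lborel A" by (simp add: emeasure_space_1)
  finally show "emeasure (smear \<delta> \<eta> \<mu>) A \<le> ennreal (1 / (pi * \<delta>\<^sup>2)) * emeasure lborel A" .
qed (use \<delta> in simp)

lemma AE_smear:
  assumes "B \<in> sets borel" and "AE z in \<mu>. ball (\<eta> z) \<delta> \<subseteq> B"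
  shows "AE w in smear \<delta> \<eta> \<mu>. w \<in> B"
proof -
  have "emeasure (smear \<delta> \<eta> \<mu>) (- B) = (\<integral>\<^sup>+z. emeasure (disc_measure \<delta> (\<eta> z)) (- B) \<partial>\<mu>)"
    using assms(1) by (intro emeasure_smear) auto
  also have "\<dots> = (\<integral>\<^sup>+z. 0 \<partial>\<mu>)"
  proof (rule nn_integral_cong_AE, use assms(2) in eventually_elim)
    fix z assume "ball (\<eta> z) \<delta> \<subseteq> B"
    then have "ball (\<eta> z) \<delta> \<inter> - B = {}" by auto
    then show "emeasure (disc_measure \<delta> (\<eta> z)) (- B) = 0" using assms(1) by simp
  qed
  finally have "- B \<in> null_sets (smear \<delta> \<eta> \<mu>)" using assms(1) sets_smear by (simp add: null_sets_def)
  from AE_not_in[OF this] show ?thesis by simp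
qed

lemma integral_smear_le:
  fixes F :: "complex \<Rightarrow> real"
  assumes F: "F \<in> borel_measurable borel" "\<And>w. F w \<ge> 0"
    and int: "integrable \<mu> F" "integrable (smear \<delta> \<eta> \<mu>) F" and "e \<ge> 0"
    and le: "AE z in \<mu>. \<forall>w\<in>ball (\<eta> z) \<delta>. F w \<le> F z + e"
  shows "(\<integral>w. F w \<partial>smear \<delta> \<eta> \<mu>) \<le> (\<integral>w. F w \<partial>\<mu>) + e"
proof -
  interpret prob_space \<mu> by (rule \<mu>(1))
  note [measurable_cong] = \<mu>(2)
  have "ennreal (\<integral>w. F w \<partial>smear \<delta> \<eta> \<mu>) = (\<integral>\<^sup>+w. ennreal (F w) \<partial>smear \<delta> \<eta> \<mu>)"
    by (rule nn_integral_eq_integral[symmetric, OF int(2)]) (use F in auto)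
  also have "\<dots> = (\<integral>\<^sup>+z. (\<integral>\<^sup>+w. ennreal (F w) \<partial>disc_measure \<delta> (\<eta> z)) \<partial>\<mu>)"
    by (rule nn_integral_smear) (use F in auto)
  also have "\<dots> \<le> (\<integral>\<^sup>+z. ennreal (F z + e) \<partial>\<mu>)"
  proof (rule nn_integral_mono_AE, use le in eventually_elim)
    fix z assume le: "\<forall>w\<in>ball (\<eta> z) \<delta>. F w \<le> F z + e"
    interpret D: prob_space "disc_measure \<delta> (\<eta> z)"
      using bounded_density_disc[OF \<delta>] by (simp add: bounded_density_def)
    have "(\<integral>\<^sup>+w. ennreal (F w) \<partial>disc_measure \<delta> (\<eta> z)) \<le> (\<integral>\<^sup>+w. ennreal (F z + e) \<partial>disc_measure \<delta> (\<eta> z))"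
      by (rule nn_integral_mono_AE)
         (use AE_disc_measure[where c = "\<eta> z" and \<delta> = \<delta>] le in \<open>auto elim!: eventually_mono intro!: ennreal_leI\<close>)
    then show "(\<integral>\<^sup>+w. ennreal (F w) \<partial>disc_measure \<delta> (\<eta> z)) \<le> ennreal (F z + e)"
      using D.emeasure_space_1 by simp
  qed
  also have "\<dots> = ennreal (\<integral>z. F z + e \<partial>\<mu>)"
    by (rule nn_integral_eq_integral) (use int F \<open>e \<ge> 0\<close> in auto)
  also have "(\<integral>z. F z + e \<partial>\<mu>) = (\<integral>w. F w \<partial>\<mu>) + e" using int by (simp add: prob_space)
  finally show ?thesis
    by (subst (asm) ennreal_le_iff) (use F \<open>e \<ge> 0\<close> in auto)
qed

text \<open>
  Smearing moves points by at most \<open>5 \<delta>\<close>. For \<open>\<bar>z - z'\<bar> \<ge> K \<delta>\<close> all distances between the discs of \<open>z\<close>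
  and \<open>z'\<close> are therefore at least \<open>(1 - 10 / K) \<bar>z - z'\<bar> = exp (- s) \<bar>z - z'\<bar>\<close>, so that the kernel
  increases by at most \<open>s\<close>. For \<open>\<bar>z - z'\<bar> < K \<delta>\<close> the averaged kernel is at most
  \<open>ln (1 / \<delta>) + 2 \<le> ln (1 / \<bar>z - z'\<bar>) + ln K + 2\<close>.
\<close>
lemma log_energy_smear_le:
  assumes R: "R > 0" "\<delta> \<le> 2 * R" "AE w in \<mu>. cmod w \<le> R" "AE w in smear \<delta> \<eta> \<mu>. cmod w \<le> R"
    and near: "AE z in \<mu>. cmod (\<eta> z - z) \<le> 4 * \<delta>"
    and fin: "(\<integral>\<^sup>+p. ennreal (ln (2 * R / cmod (fst p - snd p))) \<partial>(\<mu> \<Otimes>\<^sub>M \<mu>)) < \<infinity>"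
    and off: "AE p in \<mu> \<Otimes>\<^sub>M \<mu>. fst p \<noteq> snd p"
    and s: "s > 0" and K: "K = 10 / (1 - exp (- s))"
  shows "log_energy (smear \<delta> \<eta> \<mu>)
    \<le> log_energy \<mu> + s + (ln K + 2) * measure (\<mu> \<Otimes>\<^sub>M \<mu>) {p. cmod (fst p - snd p) < K * \<delta>}"
proof -
  interpret prob_space \<mu> by (rule \<mu>(1))
  interpret P: pair_prob_space \<mu> \<mu> ..
  note [measurable_cong] = \<mu>(2)
  define \<nu> where "\<nu> = smear \<delta> \<eta> \<mu>"
  have \<nu>: "bounded_density (1 / (pi * \<delta>\<^sup>2)) \<nu>" unfolding \<nu>_def by (rule bounded_density_smear)
  then have \<nu>': "prob_space \<nu>" "sets \<nu> = sets borel" by (auto simp: bounded_density_def)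
  note [measurable_cong] = \<nu>'(2)
  interpret N: prob_space \<nu> by (rule \<nu>'(1))
  interpret NP: pair_prob_space \<nu> \<nu> ..
  have "1 - exp (- s) > 0" using s by simp
  then have K10: "K \<ge> 10" "K * (1 - exp (- s)) = 10"
    unfolding K by (simp_all only: pos_le_divide_eq nonzero_divide_eq_eq times_divide_eq_left) auto
  define C where "C = ln K + 2"
  have C0: "C \<ge> 0" "ln K \<ge> 0" using K10 by (auto simp: C_def)
  define k where "k z w = ennreal (ln (2 * R / cmod (w - z)))" for z w
  have [measurable]: "(\<lambda>p. k (fst p) (snd p)) \<in> borel_measurable (borel \<Otimes>\<^sub>M borel)"
    unfolding k_def by measurable
  define Close where "Close = {p::complex \<times> complex. cmod (fst p - snd p) < K * \<delta>}"
  have Close: "Close \<in> sets (\<mu> \<Otimes>\<^sub>M \<mu>)"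
  proof -
    have "{p \<in> space (\<mu> \<Otimes>\<^sub>M \<mu>). cmod (fst p - snd p) < K * \<delta>} \<in> sets (\<mu> \<Otimes>\<^sub>M \<mu>)" by measurable
    moreover have "space (\<mu> \<Otimes>\<^sub>M \<mu>) = UNIV" using sets_eq_imp_space_eq[OF \<mu>(2)] by (simp add: space_pair_measure)
    ultimately show ?thesis by (simp add: Close_def)
  qed
  \<comment> \<open>An upper bound for the kernel averaged over the disc of \<open>z'\<close>, from any point of the disc of \<open>z\<close>.\<close>
  define \<Psi> where "\<Psi> p = (if fst p = snd p then \<top> else
     k (fst p) (snd p) + ennreal s + ennreal C * indicator Close p)" for p
  have \<Psi>m [measurable]: "\<Psi> \<in> borel_measurable (\<mu> \<Otimes>\<^sub>M \<mu>)"
  proof -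
    have "(\<lambda>p. if cmod (fst p - snd p) = 0 then \<top> else
       k (fst p) (snd p) + ennreal s + ennreal C * indicator Close p) \<in> borel_measurable (\<mu> \<Otimes>\<^sub>M \<mu>)"
      using Close unfolding k_def by measurable
    then show ?thesis by (simp add: \<Psi>_def[abs_def])
  qed

  have inner: "(\<integral>\<^sup>+w'. k w w' \<partial>disc_measure \<delta> (\<eta> z')) \<le> \<Psi> (z, z')"
    if z: "cmod z \<le> R" "cmod (\<eta> z - z) \<le> 4 * \<delta>" and z': "cmod z' \<le> R" "cmod (\<eta> z' - z') \<le> 4 * \<delta>"
      and w: "w \<in> ball (\<eta> z) \<delta>" for z z' w
  proof (cases "z = z'")
    case False
    interpret D: prob_space "disc_measure \<delta> (\<eta> z')"
      using bounded_density_disc[OF \<delta>] by (simp add: bounded_density_def)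
    have d: "0 < cmod (z - z')" "cmod (z - z') \<le> 2 * R"
      using False norm_triangle_ineq4[of z z'] z z' by auto
    have ln0: "ln (2 * R / cmod (z - z')) \<ge> 0" using d by (intro ln_ge_zero) simp
    have wz: "cmod (w - z) \<le> 5 * \<delta>"
      using w z(2) norm_triangle_ineq[of "w - \<eta> z" "\<eta> z - z"] by (simp add: dist_norm norm_minus_commute)
    show ?thesis
    proof (cases "cmod (z - z') < K * \<delta>")
      case True
      have "(\<integral>\<^sup>+w'. k w w' \<partial>disc_measure \<delta> (\<eta> z'))
          \<le> ennreal (ln (2 * R / \<delta>) + 1 / (pi * \<delta>\<^sup>2) * (2 * pi * \<delta>\<^sup>2))"
        unfolding k_def
        by (rule nn_integral_ln_bounded_density)
           (use bounded_density_disc[OF \<delta>, of "\<eta> z'"] \<delta> R in \<open>auto simp: bounded_density_def\<close>)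
      also have "1 / (pi * \<delta>\<^sup>2) * (2 * pi * \<delta>\<^sup>2) = 2" using \<delta> by simp
      also have "ln (2 * R / \<delta>) + 2 \<le> ln (2 * R / cmod (z - z')) + C"
      proof -
        have "ln (cmod (z - z')) \<le> ln (K * \<delta>)" using True d by (intro ln_mono) auto
        also have "\<dots> = ln K + ln \<delta>" using K10 \<delta> by (simp add: ln_mult)
        finally show ?thesis using R d \<delta> by (simp add: ln_div C_def)
      qed
      also have "ennreal (ln (2 * R / cmod (z - z')) + C) = k z z' + ennreal C"
        using ln0 C0 by (simp add: k_def norm_minus_commute)
      also have "\<dots> \<le> \<Psi> (z, z')" using False True
        by (simp add: \<Psi>_def Close_def add_increasing2 add_right_mono)
      finally show ?thesis by (simp add: ennreal_leI)
    next
      case False2: False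
      have "(\<integral>\<^sup>+w'. k w w' \<partial>disc_measure \<delta> (\<eta> z'))
        \<le> (\<integral>\<^sup>+w'. k z z' + ennreal s \<partial>disc_measure \<delta> (\<eta> z'))"
      proof (rule nn_integral_mono_AE, use AE_disc_measure in eventually_elim)
        fix w' assume w': "w' \<in> ball (\<eta> z') \<delta>"
        have "cmod (w' - z') \<le> 5 * \<delta>"
          using w' z'(2) norm_triangle_ineq[of "w' - \<eta> z'" "\<eta> z' - z'"] by (simp add: dist_norm norm_minus_commute)
        moreover have "cmod (z - z') \<le> cmod (w' - z') + cmod ((w - w') - (w - z))"
          using norm_triangle_ineq[of "w' - z'" "(w - w') - (w - z)"] by simp
        ultimately have "cmod (z - z') \<le> 10 * \<delta> + cmod (w - w')"
          using wz norm_triangle_ineq4[of "w - w'" "w - z"] by linarith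
        moreover have "10 * \<delta> \<le> (1 - exp (- s)) * cmod (z - z')"
        proof -
          have "10 * \<delta> = (1 - exp (- s)) * (K * \<delta>)" using K10(2) by (simp add: mult_ac)
          also have "\<dots> \<le> (1 - exp (- s)) * cmod (z - z')"
            using False2 s by (intro mult_left_mono) auto
          finally show ?thesis .
        qed
        ultimately have low: "exp (- s) * cmod (z - z') \<le> cmod (w - w')" by (simp add: algebra_simps)
        then have pos: "0 < cmod (w - w')" using d(1) by (meson exp_gt_zero less_le_trans mult_pos_pos)
        have "ln (exp (- s) * cmod (z - z')) \<le> ln (cmod (w - w'))"
          using low d by (intro ln_mono) auto
        then have "ln (2 * R / cmod (w - w')) \<le> ln (2 * R / cmod (z - z')) + s"
          using d pos R by (simp add: ln_div ln_mult)
        then have "ennreal (ln (2 * R / cmod (w - w'))) \<le> ennreal (ln (2 * R / cmod (z - z')) + s)"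
          by (rule ennreal_leI)
        then show "k w w' \<le> k z z' + ennreal s"
          using ln0 s by (simp add: k_def norm_minus_commute)
      qed
      also have "\<dots> = k z z' + ennreal s" using D.emeasure_space_1 by simp
      also have "\<dots> \<le> \<Psi> (z, z')" using False by (simp add: \<Psi>_def add_increasing2)
      finally show ?thesis .
    qed
  qed (simp add: \<Psi>_def)

  have good: "AE z in \<mu>. cmod z \<le> R \<and> cmod (\<eta> z - z) \<le> 4 * \<delta>"
    using R(3) near by eventually_elim simp
  have km: "(\<lambda>w'. k w w') \<in> borel_measurable borel" for w unfolding k_def by measurable
  have "ennreal (ln (2 * R) + log_energy \<nu>)
      = (\<integral>\<^sup>+p. ennreal (ln (2 * R / cmod (fst p - snd p))) \<partial>(\<nu> \<Otimes>\<^sub>M \<nu>))"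
  proof (rule log_kernel_integrable(2)[symmetric])
    show "AE p in \<nu> \<Otimes>\<^sub>M \<nu>. fst p \<noteq> snd p" by (rule bounded_density_offdiag[OF \<nu>])
    show "(\<integral>\<^sup>+p. ennreal (ln (2 * R / cmod (fst p - snd p))) \<partial>(\<nu> \<Otimes>\<^sub>M \<nu>)) < \<infinity>"
      by (rule bounded_density_kernel_finite[OF \<nu> R(1)])
    show "AE w in \<nu>. cmod w \<le> R" using R(4) unfolding \<nu>_def .
  qed (rule \<nu>' R(1))+
  also have "\<dots> = (\<integral>\<^sup>+w. (\<integral>\<^sup>+w'. k w w' \<partial>\<nu>) \<partial>\<nu>)"
    unfolding k_def by (subst N.nn_integral_fst[symmetric]) (auto simp: norm_minus_commute)
  also have "\<dots> = (\<integral>\<^sup>+z. (\<integral>\<^sup>+w. (\<integral>\<^sup>+w'. k w w' \<partial>\<nu>) \<partial>disc_measure \<delta> (\<eta> z)) \<partial>\<mu>)"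
  proof -
    have "(\<lambda>w. \<integral>\<^sup>+w'. k w w' \<partial>\<nu>) \<in> borel_measurable borel"
      unfolding k_def by measurable
    then show ?thesis unfolding \<nu>_def by (rule nn_integral_smear)
  qed
  also have "\<dots> \<le> (\<integral>\<^sup>+z. (\<integral>\<^sup>+z'. \<Psi> (z, z') \<partial>\<mu>) \<partial>\<mu>)"
  proof (rule nn_integral_mono_AE, use good in eventually_elim)
    fix z assume z: "cmod z \<le> R \<and> cmod (\<eta> z - z) \<le> 4 * \<delta>"
    interpret D: prob_space "disc_measure \<delta> (\<eta> z)"
      using bounded_density_disc[OF \<delta>] by (simp add: bounded_density_def)
    have "(\<integral>\<^sup>+w. (\<integral>\<^sup>+w'. k w w' \<partial>\<nu>) \<partial>disc_measure \<delta> (\<eta> z))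
        \<le> (\<integral>\<^sup>+w. (\<integral>\<^sup>+z'. \<Psi> (z, z') \<partial>\<mu>) \<partial>disc_measure \<delta> (\<eta> z))"
    proof (rule nn_integral_mono_AE, use AE_disc_measure in eventually_elim)
      fix w assume w: "w \<in> ball (\<eta> z) \<delta>"
      have "(\<integral>\<^sup>+w'. k w w' \<partial>\<nu>) = (\<integral>\<^sup>+z'. (\<integral>\<^sup>+w'. k w w' \<partial>disc_measure \<delta> (\<eta> z')) \<partial>\<mu>)"
        unfolding \<nu>_def by (rule nn_integral_smear[OF km])
      also have "\<dots> \<le> (\<integral>\<^sup>+z'. \<Psi> (z, z') \<partial>\<mu>)"
        by (rule nn_integral_mono_AE, use good in eventually_elim) (use inner z w in auto)
      finally show "(\<integral>\<^sup>+w'. k w w' \<partial>\<nu>) \<le> (\<integral>\<^sup>+z'. \<Psi> (z, z') \<partial>\<mu>)" .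
    qed
    also have "\<dots> = (\<integral>\<^sup>+z'. \<Psi> (z, z') \<partial>\<mu>)" using D.emeasure_space_1 by simp
    finally show "(\<integral>\<^sup>+w. (\<integral>\<^sup>+w'. k w w' \<partial>\<nu>) \<partial>disc_measure \<delta> (\<eta> z)) \<le> (\<integral>\<^sup>+z'. \<Psi> (z, z') \<partial>\<mu>)" .
  qed
  also have "\<dots> = (\<integral>\<^sup>+p. \<Psi> p \<partial>(\<mu> \<Otimes>\<^sub>M \<mu>))" by (rule nn_integral_fst[OF \<Psi>m])
  also have "\<dots> = (\<integral>\<^sup>+p. k (fst p) (snd p) + ennreal s + ennreal C * indicator Close p \<partial>(\<mu> \<Otimes>\<^sub>M \<mu>))"
    by (rule nn_integral_cong_AE) (use off in \<open>auto simp: \<Psi>_def elim!: eventually_mono\<close>)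
  also have "\<dots> = (\<integral>\<^sup>+p. k (fst p) (snd p) \<partial>(\<mu> \<Otimes>\<^sub>M \<mu>)) + ennreal s
      + ennreal C * emeasure (\<mu> \<Otimes>\<^sub>M \<mu>) Close"
    using Close
    by (simp add: nn_integral_add P.emeasure_space_1 nn_integral_cmult_indicator)
  also have "(\<integral>\<^sup>+p. k (fst p) (snd p) \<partial>(\<mu> \<Otimes>\<^sub>M \<mu>)) = ennreal (ln (2 * R) + log_energy \<mu>)"
    using log_kernel_integrable(2)[OF \<mu> R(1,3) fin off] by (simp add: k_def norm_minus_commute)
  also have "\<dots> + ennreal s + ennreal C * emeasure (\<mu> \<Otimes>\<^sub>M \<mu>) Close
      = ennreal (ln (2 * R) + log_energy \<mu> + s + C * measure (\<mu> \<Otimes>\<^sub>M \<mu>) Close)"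
    using log_kernel_integrable(3)[OF \<mu> R(1,3) fin off] s C0
    by (simp add: P.emeasure_eq_measure ennreal_mult'[symmetric] ennreal_plus[symmetric] del: ennreal_plus)
  finally have "ln (2 * R) + log_energy \<nu> \<le> ln (2 * R) + log_energy \<mu> + s + C * measure (\<mu> \<Otimes>\<^sub>M \<mu>) Close"
    by (subst (asm) ennreal_le_iff)
       (use log_kernel_integrable(3)[OF \<mu> R(1,3) fin off] s C0 in auto)
  then show ?thesis by (simp add: \<nu>_def C_def Close_def)
qed

end

section \<open>Approximation in energy by measures with bounded density\<close>

lemma diagonal_neighbourhood_small:
  fixes \<mu> :: "complex measure"
  assumes \<mu>: "prob_space \<mu>" "sets \<mu> = sets borel"
    and off: "AE p in \<mu> \<Otimes>\<^sub>M \<mu>. fst p \<noteq> snd p" and "e > 0"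
  obtains r where "r > 0" "measure (\<mu> \<Otimes>\<^sub>M \<mu>) {p. cmod (fst p - snd p) < r} < e"
proof -
  interpret prob_space \<mu> by (rule \<mu>(1))
  interpret P: pair_prob_space \<mu> \<mu> ..
  note [measurable_cong] = \<mu>(2)
  define A where "A i = {p::complex \<times> complex. cmod (fst p - snd p) < 1 / real (Suc i)}" for i
  have sp: "space (\<mu> \<Otimes>\<^sub>M \<mu>) = UNIV" using sets_eq_imp_space_eq[OF \<mu>(2)] by (simp add: space_pair_measure)
  have A: "A i \<in> sets (\<mu> \<Otimes>\<^sub>M \<mu>)" for i
  proof -
    have "{p \<in> space (\<mu> \<Otimes>\<^sub>M \<mu>). cmod (fst p - snd p) < 1 / real (Suc i)} \<in> sets (\<mu> \<Otimes>\<^sub>M \<mu>)" by measurable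
    then show ?thesis by (simp add: A_def sp)
  qed
  have "decseq A"
  proof (rule decseq_SucI)
    fix i
    have "1 / real (Suc (Suc i)) \<le> 1 / real (Suc i)" by (simp add: field_simps)
    then show "A (Suc i) \<subseteq> A i" unfolding A_def by force
  qed
  then have lim: "(\<lambda>i. measure (\<mu> \<Otimes>\<^sub>M \<mu>) (A i)) \<longlonglongrightarrow> measure (\<mu> \<Otimes>\<^sub>M \<mu>) (\<Inter>i. A i)"
    using A by (intro P.finite_Lim_measure_decseq) auto
  have D: "(\<Inter>i. A i) = {p. fst p = snd p}"
  proof safe
    fix a b assume ab: "(a, b) \<in> (\<Inter>i. A i)"
    show "fst (a, b) = snd (a, b)"
    proof (rule ccontr)
      assume "fst (a, b) \<noteq> snd (a, b)"
      then have "cmod (a - b) > 0" by simp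
      then obtain i where "1 / real (Suc i) < cmod (a - b)" using nat_approx_posE by metis
      moreover have "cmod (a - b) < 1 / real (Suc i)" using ab by (auto simp: A_def)
      ultimately show False by simp
    qed
  qed (auto simp: A_def)
  have "(\<Inter>i. A i) \<in> sets (\<mu> \<Otimes>\<^sub>M \<mu>)" using A by (intro sets.countable_INT) auto
  then have "measure (\<mu> \<Otimes>\<^sub>M \<mu>) (\<Inter>i. A i) = measure (\<mu> \<Otimes>\<^sub>M \<mu>) {}"
    using off unfolding D by (intro measure_eq_AE) (auto elim!: eventually_mono)
  then have "(\<lambda>i. measure (\<mu> \<Otimes>\<^sub>M \<mu>) (A i)) \<longlonglongrightarrow> 0" using lim by simp
  then have "eventually (\<lambda>i. measure (\<mu> \<Otimes>\<^sub>M \<mu>) (A i) < e) sequentially"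
    using \<open>e > 0\<close> by (rule order_tendstoD)
  then obtain i where "measure (\<mu> \<Otimes>\<^sub>M \<mu>) (A i) < e" by (auto simp: eventually_sequentially)
  then show ?thesis by (intro that[of "1 / real (Suc i)"]) (auto simp: A_def)
qed

text \<open>
  The error \<open>e\<close> is split into three equal parts \<open>s\<close>: the distortion of distances between remote points,
  the pairs of points close to the diagonal, and the oscillation of the potential at scale \<open>5 \<delta>\<close>.
\<close>
lemma approximation_by_bounded_densities:
  assumes \<mu>: "\<mu> \<in> compact_prob_measures (- U)" "weighted_energy g \<mu> \<noteq> \<infinity>"
    and U: "open U" "exterior_ball_condition U"
    and g: "continuous_on {0..} g" "\<And>r. r \<ge> 0 \<Longrightarrow> g r \<ge> 0" and "e > 0"
  obtains M \<nu> R where "bounded_density M \<nu>" "R > 0" "AE w in \<nu>. cmod w \<le> R" "AE w in \<nu>. w \<notin> U"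
    "ereal (log_energy \<nu> + (\<integral>w. g (cmod w) \<partial>\<nu>)) \<le> weighted_energy g \<mu> + ereal e"
proof -
  note \<mu>' = compact_prob_measuresD[OF \<mu>(1)]
  obtain R0 where R0: "R0 > 0" "AE w in \<mu>. cmod w \<le> R0" using \<mu>'(4) by auto
  \<comment> \<open>Smearing with \<open>\<delta> \<le> 1\<close> moves points by at most 5, so this disc carries the smeared measure too.\<close>
  define R where "R = R0 + 5"
  have R: "R > 0" "AE w in \<mu>. cmod w \<le> R"
    using R0 by (auto simp: R_def elim!: eventually_mono)
  note fe = finite_weighted_energy[OF \<mu>'(1,2) R \<mu>(2)]
  define s where "s = e / 3"
  have s: "s > 0" using \<open>e > 0\<close> by (simp add: s_def)
  define K where "K = 10 / (1 - exp (- s))"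
  have "1 - exp (- s) > 0" using s by simp
  then have K: "K \<ge> 10" unfolding K_def by (simp add: pos_le_divide_eq)
  then have C: "ln K + 2 > 0" using ln_ge_zero[of K] by linarith
  obtain r where r: "r > 0" "measure (\<mu> \<Otimes>\<^sub>M \<mu>) {p. cmod (fst p - snd p) < r} < s / (ln K + 2)"
    using diagonal_neighbourhood_small[OF \<mu>'(1,2) fe(1), of "s / (ln K + 2)"] s C by auto
  have "uniformly_continuous_on {0..R} g"
    by (rule compact_uniformly_continuous[OF continuous_on_subset[OF g(1)]]) auto
  then obtain d where d: "d > 0"
    "\<And>x y. x \<in> {0..R} \<Longrightarrow> y \<in> {0..R} \<Longrightarrow> \<bar>x - y\<bar> < d \<Longrightarrow> \<bar>g x - g y\<bar> < s"
    using s unfolding uniformly_continuous_on_def dist_real_def by meson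
  obtain \<epsilon> where \<epsilon>: "\<epsilon> > 0"
    "\<And>\<delta> z. 0 < \<delta> \<Longrightarrow> \<delta> \<le> \<epsilon> \<Longrightarrow> z \<notin> U \<Longrightarrow> \<exists>\<eta>. ball \<eta> \<delta> \<subseteq> - U \<and> cmod (\<eta> - z) \<le> 2 * \<delta>"
    using exterior_ball_all_scales[OF U] by metis
  define \<delta> where "\<delta> = min (min \<epsilon> 1) (min (r / K) (d / 5))"
  have \<delta>: "\<delta> > 0" "\<delta> \<le> \<epsilon>" "\<delta> \<le> 1" "\<delta> \<le> r / K" "\<delta> \<le> d / 5"
  proof -
    have "r / K > 0" using r(1) K by simp
    then show "\<delta> > 0" using \<epsilon>(1) d(1) by (simp add: \<delta>_def)
  qed (unfold \<delta>_def, linarith+)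
  obtain \<eta> where \<eta>: "\<eta> \<in> measurable borel borel"
    "\<And>z. z \<in> - U \<Longrightarrow> ball (\<eta> z) \<delta> \<subseteq> - U" "\<And>z. z \<in> - U \<Longrightarrow> cmod (\<eta> z - z) \<le> 4 * \<delta>"
    using measurable_ball_centres[OF \<delta>(1), of "- U"] \<epsilon>(2)[OF \<delta>(1,2)] by auto
  define \<nu> where "\<nu> = smear \<delta> \<eta> \<mu>"
  have \<nu>: "bounded_density (1 / (pi * \<delta>\<^sup>2)) \<nu>"
    unfolding \<nu>_def by (rule bounded_density_smear[OF \<delta>(1) \<eta>(1) \<mu>'(1,2)])
  then have \<nu>': "prob_space \<nu>" "sets \<nu> = sets borel" by (auto simp: bounded_density_def)
  have moved: "cmod (w - z) < 5 * \<delta>" if "z \<in> - U" "w \<in> ball (\<eta> z) \<delta>" for z w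
    using \<eta>(3)[OF that(1)] that(2) norm_triangle_ineq[of "w - \<eta> z" "\<eta> z - z"]
    by (simp add: dist_norm norm_minus_commute)
  have good: "AE z in \<mu>. z \<in> - U \<and> cmod z \<le> R0" using \<mu>'(3) R0(2) by eventually_elim simp
  have near: "AE z in \<mu>. \<forall>w\<in>ball (\<eta> z) \<delta>. cmod w \<le> R"
    using good
  proof eventually_elim
    case (elim z)
    show ?case
    proof
      fix w assume "w \<in> ball (\<eta> z) \<delta>"
      then have "cmod (w - z) < 5 * \<delta>" using moved elim by blast
      then show "cmod w \<le> R"
        using norm_triangle_ineq[of z "w - z"] elim \<delta>(3) by (simp add: R_def)
    qed
  qed
  have nuR: "AE w in \<nu>. cmod w \<le> R"
  proof -
    have "AE w in \<nu>. w \<in> cball 0 R"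
      unfolding \<nu>_def
      by (rule AE_smear[OF \<delta>(1) \<eta>(1) \<mu>'(1,2)]) (use near in \<open>auto elim!: eventually_mono\<close>)
    then show ?thesis by simp
  qed
  have nuU: "AE w in \<nu>. w \<notin> U"
  proof -
    have "AE w in \<nu>. w \<in> - U"
      unfolding \<nu>_def
      by (rule AE_smear[OF \<delta>(1) \<eta>(1) \<mu>'(1,2)])
         (use good \<eta>(2) U(1) in \<open>auto elim!: eventually_mono intro: borel_open\<close>)
    then show ?thesis by simp
  qed
  have "log_energy \<nu> \<le> log_energy \<mu> + s + (ln K + 2) * measure (\<mu> \<Otimes>\<^sub>M \<mu>) {p. cmod (fst p - snd p) < K * \<delta>}"
    unfolding \<nu>_def
  proof (rule log_energy_smear_le[OF \<delta>(1) \<eta>(1) \<mu>'(1,2) R(1) _ R(2) _ _ fe(2,1) s K_def])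
    show "\<delta> \<le> 2 * R" using \<delta>(3) R0(1) by (simp add: R_def)
    show "AE w in smear \<delta> \<eta> \<mu>. cmod w \<le> R" using nuR unfolding \<nu>_def .
    show "AE z in \<mu>. cmod (\<eta> z - z) \<le> 4 * \<delta>" using good \<eta>(3) by (auto elim!: eventually_mono)
  qed
  also have "measure (\<mu> \<Otimes>\<^sub>M \<mu>) {p. cmod (fst p - snd p) < K * \<delta>}
      \<le> measure (\<mu> \<Otimes>\<^sub>M \<mu>) {p. cmod (fst p - snd p) < r}"
  proof -
    interpret prob_space \<mu> by (rule \<mu>'(1))
    interpret P: pair_prob_space \<mu> \<mu> ..
    note [measurable_cong] = \<mu>'(2)
    have sp: "space (\<mu> \<Otimes>\<^sub>M \<mu>) = UNIV"
      using sets_eq_imp_space_eq[OF \<mu>'(2)] by (simp add: space_pair_measure)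
    have "{p \<in> space (\<mu> \<Otimes>\<^sub>M \<mu>). cmod (fst p - snd p) < r} \<in> sets (\<mu> \<Otimes>\<^sub>M \<mu>)" by measurable
    moreover have "K * \<delta> \<le> r" using \<delta>(4) K by (simp add: pos_le_divide_eq mult.commute)
    ultimately show ?thesis by (intro P.finite_measure_mono) (auto simp: sp)
  qed
  also have "(ln K + 2) * \<dots> \<le> (ln K + 2) * (s / (ln K + 2))"
    using r(2) C by (intro mult_left_mono) auto
  also have "\<dots> = s" using C by simp
  finally have 1: "log_energy \<nu> \<le> log_energy \<mu> + s + s"
    using C by (simp add: mult_left_mono)
  have 2: "(\<integral>w. g (cmod w) \<partial>\<nu>) \<le> (\<integral>w. g (cmod w) \<partial>\<mu>) + s"
    unfolding \<nu>_def
  proof (rule integral_smear_le[OF \<delta>(1) \<eta>(1) \<mu>'(1,2)])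
    show "(\<lambda>w. g (cmod w)) \<in> borel_measurable borel" by (rule measurable_radial[OF g(1)])
    show "integrable \<mu> (\<lambda>w. g (cmod w))" by (rule integrable_radial_potential[OF \<mu>'(1,2) R(2) g(1)])
    show "integrable (smear \<delta> \<eta> \<mu>) (\<lambda>w. g (cmod w))"
      using integrable_radial_potential[OF \<nu>' nuR g(1)] by (simp add: \<nu>_def)
    show "AE z in \<mu>. \<forall>w\<in>ball (\<eta> z) \<delta>. g (cmod w) \<le> g (cmod z) + s"
      using good near
    proof eventually_elim
      case (elim z)
      show ?case
      proof
        fix w assume w: "w \<in> ball (\<eta> z) \<delta>"
        then have "cmod (w - z) < d" using moved[of z w] elim \<delta>(5) by auto
        then have "\<bar>cmod w - cmod z\<bar> < d" using norm_triangle_ineq3[of w z] by simp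
        moreover have "cmod w \<in> {0..R}" "cmod z \<in> {0..R}" using w elim by (auto simp: R_def)
        ultimately have "\<bar>g (cmod w) - g (cmod z)\<bar> < s" by (intro d(2))
        then show "g (cmod w) \<le> g (cmod z) + s" by simp
      qed
    qed
  qed (use g s in auto)
  show ?thesis
  proof (rule that[OF \<nu> R(1) nuR nuU])
    show "ereal (log_energy \<nu> + (\<integral>w. g (cmod w) \<partial>\<nu>)) \<le> weighted_energy g \<mu> + ereal e"
      using 1 2 unfolding fe(3) by (simp add: s_def)
  qed
qed

section \<open>Exponential rates\<close>

lemma hole_integral_asymptotic_lower:
  assumes \<nu>: "bounded_density M \<nu>" and R: "R > 0" "AE w in \<nu>. cmod w \<le> R"
    and U: "U \<in> sets borel" "AE w in \<nu>. w \<notin> U"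
    and cont: "continuous_on {0..} g"
    and int: "\<And>n. n > 0 \<Longrightarrow> integrable (lebesgue_n n) (ensemble_weight g n)" and "e > 0"
  shows "eventually (\<lambda>n. hole_integral g n U > 0 \<and>
    ln (hole_integral g n U) / (real n)\<^sup>2 > - (log_energy \<nu> + (\<integral>w. g (cmod w) \<partial>\<nu>)) - e) sequentially"
proof -
  define E where "E = log_energy \<nu>"
  define G where "G = (\<integral>w. g (cmod w) \<partial>\<nu>)"
  have M: "M > 0" using \<nu> by (simp add: bounded_density_def)
  have bound: "hole_integral g n U > 0 \<and>
     ln (hole_integral g n U) / (real n)\<^sup>2 \<ge> - ((1 - 1 / real n) * E) - G - ln M / real n" if n: "n > 0" for n
  proof -
    have le: "exp (- (real n * (real n - 1) * E) - (real n)\<^sup>2 * G) \<le> M ^ n * hole_integral g n U"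
      unfolding E_def G_def by (rule hole_integral_lower[OF \<nu> R U cont int[OF n]])
    then have "M ^ n * hole_integral g n U > 0" by (meson exp_gt_zero less_le_trans)
    then have pos: "hole_integral g n U > 0" using M by (simp add: zero_less_mult_iff)
    have "- (real n * (real n - 1) * E) - (real n)\<^sup>2 * G \<le> ln (M ^ n * hole_integral g n U)"
      using le pos M by (subst ln_ge_iff) auto
    also have "\<dots> = real n * ln M + ln (hole_integral g n U)"
      using pos M by (simp add: ln_mult ln_realpow)
    finally have "(- (real n * (real n - 1) * E) - (real n)\<^sup>2 * G - real n * ln M) / (real n)\<^sup>2
        \<le> ln (hole_integral g n U) / (real n)\<^sup>2"
      by (intro divide_right_mono) auto
    moreover have "(- (real n * (real n - 1) * E) - (real n)\<^sup>2 * G - real n * ln M) / (real n)\<^sup>2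
        = - ((1 - 1 / real n) * E) - G - ln M / real n"
      using n by (simp add: field_simps power2_eq_square)
    ultimately show ?thesis using pos by simp
  qed
  have inv: "(\<lambda>n. 1 / real n) \<longlonglongrightarrow> 0" by (rule lim_1_over_n)
  have "(\<lambda>n. - ((1 - 1 / real n) * E) - G - ln M * (1 / real n)) \<longlonglongrightarrow> - ((1 - 0) * E) - G - ln M * 0"
    by (intro tendsto_intros inv)
  then have "eventually (\<lambda>n. - ((1 - 1 / real n) * E) - G - ln M * (1 / real n) > - (E + G) - e) sequentially"
    by (rule order_tendstoD) (use \<open>e > 0\<close> in auto)
  then have "eventually (\<lambda>n. hole_integral g n U > 0 \<and>
    ln (hole_integral g n U) / (real n)\<^sup>2 > - (E + G) - e) sequentially"
    using eventually_gt_at_top[of 0]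
  proof eventually_elim
    case (elim n)
    then show ?case using bound[of n] by auto
  qed
  then show ?thesis unfolding E_def G_def .
qed

lemma hole_integral_empty: "hole_integral g n {} = partition_fun g n"
  unfolding hole_integral_def partition_fun_def
  by (intro Bochner_Integration.integral_cong refl) (auto simp: hole_configs_iff indicator_def)

lemma hole_prob_eq:
  assumes U: "U \<in> sets borel" and int: "integrable (lebesgue_n n) (ensemble_weight g n)"
    and Z: "partition_fun g n > 0"
  shows "hole_prob g n U = hole_integral g n U / partition_fun g n"
proof -
  have H: "hole_configs n U \<in> sets (lebesgue_n n)" by (rule sets_hole_configs[OF U])
  have m: "(\<lambda>z. ensemble_weight g n z / partition_fun g n) \<in> borel_measurable (lebesgue_n n)"
    using borel_measurable_integrable[OF int] by measurable
  have intH: "integrable (lebesgue_n n) (\<lambda>z. indicator (hole_configs n U) z * ensemble_weight g n z / partition_fun g n)"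
    using int H by (simp add: integrable_real_mult_indicator mult.commute)
  have "emeasure (ensemble_law g n) (hole_configs n U)
     = (\<integral>\<^sup>+z. ennreal (ensemble_weight g n z / partition_fun g n) * indicator (hole_configs n U) z \<partial>lebesgue_n n)"
    unfolding ensemble_law_def by (rule emeasure_density) (use m H in auto)
  also have "\<dots> = (\<integral>\<^sup>+z. ennreal (indicator (hole_configs n U) z * ensemble_weight g n z / partition_fun g n) \<partial>lebesgue_n n)"
    by (intro nn_integral_cong) (auto simp: indicator_def)
  also have "\<dots> = ennreal (\<integral>z. indicator (hole_configs n U) z * ensemble_weight g n z / partition_fun g n \<partial>lebesgue_n n)"
    by (rule nn_integral_eq_integral[OF intH])
       (use Z in \<open>auto simp: ensemble_weight_nonneg indicator_def\<close>)
  also have "(\<integral>z. indicator (hole_configs n U) z * ensemble_weight g n z / partition_fun g n \<partial>lebesgue_n n)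
      = hole_integral g n U / partition_fun g n"
    unfolding hole_integral_def by simp
  finally have em: "emeasure (ensemble_law g n) (hole_configs n U) = ennreal (hole_integral g n U / partition_fun g n)" .
  have "hole_integral g n U \<ge> 0"
    unfolding hole_integral_def
    by (intro integral_nonneg_AE) (auto simp: ensemble_weight_nonneg indicator_def)
  moreover have "hole_prob g n U = measure (ensemble_law g n) (hole_configs n U)"
    unfolding hole_prob_def hole_configs_def by (simp add: ensemble_law_def)
  ultimately show ?thesis using em Z by (simp add: measure_def)
qed

text \<open>
  Both bounds are needed because the difference of two infinite extended reals is not meaningful. The
  lower one comes from the uniform distribution on the unit disc and an empty hole.
\<close>
lemma partition_fun_exponent_bounds:
  assumes adm: "admissible_potential g g'" and cont: "continuous_on {0..} g"
  shows "\<exists>a b. eventually (\<lambda>n. partition_fun g n > 0 \<and> a \<le> ln (partition_fun g n) / (real n)\<^sup>2 \<and>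
       ln (partition_fun g n) / (real n)\<^sup>2 \<le> b) sequentially"
proof -
  obtain B where B: "B \<ge> 1" and le: "\<And>n. n > 0 \<Longrightarrow> partition_fun g n \<le> B ^ (n * n)"
    using partition_fun_upper[OF adm cont] by blast
  note int = ensemble_weight_integrable[OF adm cont]
  define \<nu> where "\<nu> = disc_measure 1 0"
  have "AE w in \<nu>. cmod w \<le> 1"
    using AE_disc_measure[of 0 1] unfolding \<nu>_def by (auto elim!: eventually_mono)
  then have "eventually (\<lambda>n. hole_integral g n {} > 0 \<and>
    ln (hole_integral g n {}) / (real n)\<^sup>2 > - (log_energy \<nu> + (\<integral>w. g (cmod w) \<partial>\<nu>)) - 1) sequentially"
    by (intro hole_integral_asymptotic_lower[where M = "1 / (pi * 1\<^sup>2)" and R = 1] cont int)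
       (use bounded_density_disc[of 1 0] in \<open>auto simp: \<nu>_def\<close>)
  then have "eventually (\<lambda>n. partition_fun g n > 0 \<and>
      - (log_energy \<nu> + (\<integral>w. g (cmod w) \<partial>\<nu>)) - 1 \<le> ln (partition_fun g n) / (real n)\<^sup>2 \<and>
       ln (partition_fun g n) / (real n)\<^sup>2 \<le> ln B) sequentially"
    using eventually_gt_at_top[of 0]
  proof eventually_elim
    case (elim n)
    then have pos: "partition_fun g n > 0" by (simp add: hole_integral_empty)
    have "ln (partition_fun g n) \<le> ln (B ^ (n * n))"
      using pos le[OF elim(2)] by (intro ln_mono) auto
    also have "\<dots> = ln B * (real n)\<^sup>2" using B by (simp add: ln_realpow power2_eq_square)
    finally have "ln (partition_fun g n) / (real n)\<^sup>2 \<le> ln B"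
      using elim(2) by (simp add: pos_divide_le_eq)
    then show ?case using elim by (simp add: hole_integral_empty)
  qed
  then show ?thesis by blast
qed

theorem theorem3p10:
  fixes g g' :: "real \<Rightarrow> real" and T :: real and U :: "complex set"
  assumes "admissible_potential g g'"
    and "T > 0" and "\<And>t. t > 0 \<Longrightarrow> t * g' t = 2 \<longleftrightarrow> t = T"
    and "(g has_real_derivative g' 0) (at 0 within {0..})"
    and "bounded (g' ` {0..T + 1})"
    and "open U" and "U \<subseteq> ball 0 T"
    and "exterior_ball_condition U"
  shows "liminf (\<lambda>n. ereal (1 / (real n)\<^sup>2) * ereal_ln (hole_prob g n U))
           \<ge> - min_energy g U - limsup (\<lambda>n. ereal (1 / (real n)\<^sup>2) * ereal_ln (partition_fun g n))"
proof -
  have cont: "continuous_on {0..} g" by (rule admissible_potential_continuous[OF assms(1,4)])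
  have g0: "\<And>r. r \<ge> 0 \<Longrightarrow> g r \<ge> 0" using admissible_potentialD(1)[OF assms(1)] .
  have Ub: "U \<in> sets borel" using \<open>open U\<close> by (rule borel_open)
  note int = ensemble_weight_integrable[OF assms(1) cont]
  define p where "p n = ereal (1 / (real n)\<^sup>2) * ereal_ln (hole_prob g n U)" for n
  define q where "q n = ereal (1 / (real n)\<^sup>2) * ereal_ln (partition_fun g n)" for n
  obtain a b where ab: "eventually (\<lambda>n. partition_fun g n > 0 \<and> a \<le> ln (partition_fun g n) / (real n)\<^sup>2 \<and>
       ln (partition_fun g n) / (real n)\<^sup>2 \<le> b) sequentially"
    using partition_fun_exponent_bounds[OF assms(1) cont] by blast
  have q: "eventually (\<lambda>n. q n = ereal (ln (partition_fun g n) / (real n)\<^sup>2)) sequentially"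
    using ab by eventually_elim (simp add: q_def ereal_ln_def)
  have "limsup q \<le> ereal b"
    by (rule Limsup_bounded) (use ab q in eventually_elim, simp)
  moreover have "ereal a \<le> limsup q"
    by (rule le_Limsup) (simp, use ab q in eventually_elim, simp)
  ultimately obtain L where L: "limsup q = ereal L" by (cases "limsup q") auto
  have main: "- weighted_energy g \<mu> - ereal L \<le> liminf p" if \<mu>: "\<mu> \<in> compact_prob_measures (- U)" for \<mu>
  proof (cases "weighted_energy g \<mu> = \<infinity>")
    case False
    note \<mu>' = compact_prob_measuresD[OF \<mu>]
    obtain W where W: "weighted_energy g \<mu> = ereal W"
      using \<mu>'(4) finite_weighted_energy(3)[OF \<mu>'(1,2) _ _ False] by blast
    have "ereal (- W - L) \<le> liminf p + ereal e" if e: "e > 0" for e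
    proof -
      have e3: "e / 3 > 0" using e by simp
      obtain M \<nu> R where \<nu>: "bounded_density M \<nu>" "R > 0" "AE w in \<nu>. cmod w \<le> R" "AE w in \<nu>. w \<notin> U"
        "log_energy \<nu> + (\<integral>w. g (cmod w) \<partial>\<nu>) \<le> W + e / 3"
        using approximation_by_bounded_densities[OF \<mu> False assms(6,8) cont g0 e3] W by auto
      have "limsup q < ereal (L + e / 3)" using L e3 by simp
      then have "eventually (\<lambda>n. q n < ereal (L + e / 3)) sequentially" by (rule Limsup_lessD)
      moreover have "eventually (\<lambda>n. hole_integral g n U > 0 \<and> ln (hole_integral g n U) / (real n)\<^sup>2
          > - (log_energy \<nu> + (\<integral>w. g (cmod w) \<partial>\<nu>)) - e / 3) sequentially"
        by (rule hole_integral_asymptotic_lower[OF \<nu>(1-3) Ub \<nu>(4) cont _ e3]) (rule int)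
      ultimately have "eventually (\<lambda>n. ereal (- W - L - e) \<le> p n) sequentially"
        using ab q eventually_gt_at_top[of 0]
      proof eventually_elim
        case (elim n)
        have "p n = ereal (ln (hole_integral g n U) / (real n)\<^sup>2 - ln (partition_fun g n) / (real n)\<^sup>2)"
        proof -
          have pos: "hole_integral g n U > 0" "partition_fun g n > 0" using elim by auto
          then have "\<not> hole_integral g n U / partition_fun g n \<le> 0" by (simp add: not_le)
          then show ?thesis
            using pos elim by (simp add: p_def hole_prob_eq[OF Ub int] ereal_ln_def ln_div diff_divide_distrib)
        qed
        moreover have "ln (partition_fun g n) / (real n)\<^sup>2 < L + e / 3" using elim by simp
        ultimately show ?case using elim \<nu>(5) by simp
      qed
      then have "ereal (- W - L - e) \<le> liminf p" by (rule Liminf_bounded)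
      then have "ereal (- W - L - e) + ereal e \<le> liminf p + ereal e" by (rule add_right_mono)
      then show ?thesis by simp
    qed
    then have "ereal (- W - L) \<le> liminf p" by (rule ereal_le_epsilon2)
    then show ?thesis by (simp add: W)
  qed simp
  have "- min_energy g U \<le> liminf p + ereal L"
  proof -
    have "- (liminf p + ereal L) \<le> min_energy g U"
      unfolding min_energy_def
    proof (rule INF_greatest)
      fix \<mu> assume "\<mu> \<in> compact_prob_measures (- U)"
      from main[OF this] show "- (liminf p + ereal L) \<le> weighted_energy g \<mu>"
        by (cases "weighted_energy g \<mu>"; cases "liminf p") auto
    qed
    then show ?thesis by (simp add: ereal_uminus_le_reorder)
  qed
  then have "- min_energy g U - ereal L \<le> liminf p"
    by (cases "min_energy g U"; cases "liminf p") auto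
  then show ?thesis unfolding p_def[symmetric, abs_def] q_def[symmetric, abs_def] L by simp
qed

end
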